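(* Let $(X,d)$ be a complete metric space, $\kappa\in\mathbb R$, and let $\mathcal V:X\to(-\infty,+\infty]$ be proper, lower semicontinuous and geodesically $\kappa$-convex, and assume that $\mathcal V$ generates a $\kappa$-flow $\mathsf S^{\mathcal V}$. Let $\mathcal U:X\to(-\infty,+\infty]$ be lower semicontinuous with $\operatorname{Dom}(\mathcal U)\subset\operatorname{Dom}(\mathcal V)$, and assume that there is $\tau_o>0$ such that for every $\tau\in(0,\tau_o]$ and every $\bar U\in X$ the functional $V\mapsto\frac1{2\tau}d^2(V,\bar U)+\mathcal U(V)$ admits a minimum point in $\operatorname{Dom}(\mathcal U)$. Let $\tau_n\in(0,\tau_o]$ $(n\ge1)$ with $\sum_n\tau_n=+\infty$, $U^0_{\boldsymbol\tau}\in X$, and let $(U^n_{\boldsymbol\tau})_{n\ge0}$ be an arbitrary sequence such that for every $n\ge1$ $$\frac1{2\tau_n}d^2(U^n_{\boldsymbol\tau},U^{n-1}_{\boldsymbol\tau})+\mathcal U(U^n_{\boldsymbol\tau})\le\frac1{2\tau_n}d^2(V,U^{n-1}_{\boldsymbol\tau})+\mathcal U(V)\qquad\text{for all }V\in\operatorname{Dom}(\mathcal U).$$ Then for every $n\ge1$ $$\mathcal V(U^n_{\boldsymbol\tau})+\tau_n\,\mathrm D^{\mathcal V}\mathcal U(U^n_{\boldsymbol\tau})+\frac\kappa2d^2(U^n_{\boldsymbol\tau},U^{n-1}_{\boldsymbol\tau})\le\mathcal V(U^{n-1}_{\boldsymbol\tau}).$$ Moreover, assume that $\kappa>0$ and that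 for some $\theta>0$ $$\mathcal U(u)=|\partial\mathcal V|^2(u)+2(\theta-\kappa)\mathcal V(u)\qquad\text{for all }u\in\operatorname{Dom}(\mathcal U).$$ Then $\mathcal V$ and $\mathcal U$ have the same minimum point $u_{\min}$, and for every $n\ge1$ $$(1+4\kappa\theta\,\tau_n)\big(\mathcal V(U^n_{\boldsymbol\tau})-\mathcal V(u_{\min})\big)\le\mathcal V(U^{n-1}_{\boldsymbol\tau})-\mathcal V(u_{\min}),$$ $$\big(1+4\theta\min\{\kappa,\theta\}\,\tau_n\big)\big(\mathcal U(U^n_{\boldsymbol\tau})-\mathcal U(u_{\min})\big)\le\mathcal U(U^{n-1}_{\boldsymbol\tau})-\mathcal U(u_{\min}).$$
   Context: $\operatorname{Dom}(\mathcal V)=\{u\in X:\mathcal V(u)<+\infty\}$, and likewise for $\mathcal U$. Geodesic $\kappa$-convexity of $\mathcal V$: any $u_0,u_1\in\operatorname{Dom}(\mathcal V)$ are joined by a curve $\vartheta\in[0,1]\mapsto u_\vartheta\in\operatorname{Dom}(\mathcal V)$ with $d(u_\vartheta,u_\eta)\le|\vartheta-\eta|d(u_0,u_1)$ and $\mathcal V(u_\vartheta)\le(1-\vartheta)\mathcal V(u_0)+\vartheta\mathcal V(u_1)-\frac\kappa2\vartheta(1-\vartheta)d^2(u_0,u_1)$ for all $\vartheta,\eta\in[0,1]$. A $\kappa$-flow of $\mathcal V$ is a continuous semigroup $\mathsf S^{\mathcal V}_t:\operatorname{Dom}(\mathcal V)\to\operatorname{Dom}(\mathcal V)$, $t\ge0$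 (each $\mathsf S_t^{\mathcal V}$ continuous, $\mathsf S^{\mathcal V}_h(\mathsf S^{\mathcal V}_tu)=\mathsf S^{\mathcal V}_{t+h}u$, $\lim_{h\downarrow0}\mathsf S^{\mathcal V}_hu=u$), satisfying for all $u,v\in\operatorname{Dom}(\mathcal V)$ and $t\ge0$ $$\frac12\frac{d^+}{dt}d^2(\mathsf S^{\mathcal V}_tu,v)+\frac\kappa2d^2(\mathsf S^{\mathcal V}_tu,v)+\mathcal V(\mathsf S^{\mathcal V}_tu)\le\mathcal V(v),$$ where $\frac{d^+}{dt}\zeta(t)=\limsup_{h\downarrow0}\frac{\zeta(t+h)-\zeta(t)}h$. Slope: $|\partial\mathcal V|(u)=\limsup_{v\to u}\frac{(\mathcal V(u)-\mathcal V(v))^+}{d(u,v)}$. Dissipation of $\mathcal U$ along $\mathsf S^{\mathcal V}$: $\mathrm D^{\mathcal V}\mathcal U(u)=\limsup_{h\downarrow0}\frac{\mathcal U(u)-\mathcal U(\mathsf S^{\mathcal V}_hu)}h$ for $u\in\operatorname{Dom}(\mathcal U)$. Inequalities are understood in the extended reals.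
   Formalization: In the "Moreover" part it is additionally assumed that the flow of V maps Dom(U) into itself; without this the claim fails (X = R, V = x²/2, κ = θ = 1, U(1) = 1 and U = +∞ elsewhere), and it holds when Dom(U) is the set where the slope of V is finite. *)

theory Defs
  imports "HOL-Analysis.Analysis"
begin

text \<open>
  Functionals with values in the half-open interval from minus infinity (excluded) to plus
  infinity (included) are functions into \<^typ>\<open>ereal\<close> that avoid the value minus infinity.
\<close>

definition Dom :: "('a \<Rightarrow> ereal) \<Rightarrow> 'a set" where
  "Dom F = {u. F u < \<infinity>}"

definition lower_semicontinuous :: "('a::topological_space \<Rightarrow> ereal) \<Rightarrow> bool" where
  "lower_semicontinuous F \<longleftrightarrow> (\<forall>u. F u \<le> Liminf (at u) F)"

definition geodesically_convex :: "real \<Rightarrow> ('a::metric_space \<Rightarrow> ereal) \<Rightarrow> bool" where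
  "geodesically_convex \<kappa> V \<longleftrightarrow>
     (\<forall>u0\<in>Dom V. \<forall>u1\<in>Dom V. \<exists>c :: real \<Rightarrow> 'a. c 0 = u0 \<and> c 1 = u1 \<and>
        (\<forall>s\<in>{0..1}. c s \<in> Dom V) \<and>
        (\<forall>s\<in>{0..1}. \<forall>r\<in>{0..1}. dist (c s) (c r) \<le> \<bar>s - r\<bar> * dist u0 u1) \<and>
        (\<forall>s\<in>{0..1}. V (c s) \<le> ereal (1 - s) * V u0 + ereal s * V u1
                               - ereal (\<kappa> / 2 * s * (1 - s) * (dist u0 u1)\<^sup>2)))"

definition upper_right_deriv :: "(real \<Rightarrow> real) \<Rightarrow> real \<Rightarrow> ereal" where
  "upper_right_deriv \<zeta> t = Limsup (at_right 0) (\<lambda>h. ereal ((\<zeta> (t + h) - \<zeta> t) / h))"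

text \<open>
  The semigroup is a total function \<open>S t u\<close>; only its values for \<open>t \<ge> 0\<close> and \<open>u \<in> Dom V\<close> are
  constrained. That \<open>S 0\<close> is the identity on \<open>Dom V\<close> follows from the
  semigroup law, the limit at time zero and uniqueness of limits.
\<close>

definition is_flow :: "real \<Rightarrow> ('a::metric_space \<Rightarrow> ereal) \<Rightarrow> (real \<Rightarrow> 'a \<Rightarrow> 'a) \<Rightarrow> bool" where
  "is_flow \<kappa> V S \<longleftrightarrow>
     (\<forall>t\<ge>0. S t \<in> Dom V \<rightarrow> Dom V \<and> continuous_on (Dom V) (S t)) \<and>
     (\<forall>u\<in>Dom V. \<forall>t\<ge>0. \<forall>h\<ge>0. S h (S t u) = S (t + h) u) \<and>
     (\<forall>u\<in>Dom V. ((\<lambda>h. S h u) \<longlongrightarrow> u) (at_right 0)) \<and>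
     (\<forall>u\<in>Dom V. \<forall>v\<in>Dom V. \<forall>t\<ge>0.
        ereal (1 / 2) * upper_right_deriv (\<lambda>r. (dist (S r u) v)\<^sup>2) t
          + ereal (\<kappa> / 2 * (dist (S t u) v)\<^sup>2) + V (S t u) \<le> V v)"

text \<open>
  The outer \<open>max 0\<close> matters only at isolated points of the space: there \<open>at u\<close> is the trivial
  filter, whose \<open>Limsup\<close> is minus infinity, while the slope is by convention zero.
  Elsewhere the upper limit of nonnegative quotients is already nonnegative.
\<close>

definition slope :: "('a::metric_space \<Rightarrow> ereal) \<Rightarrow> 'a \<Rightarrow> ereal" where
  "slope V u = max 0 (Limsup (at u) (\<lambda>v. max 0 (V u - V v) / ereal (dist u v)))"

definition dissipation :: "(real \<Rightarrow> 'a \<Rightarrow> 'a) \<Rightarrow> ('a \<Rightarrow> ereal) \<Rightarrow> 'a \<Rightarrow> ereal" where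
  "dissipation S U u = Limsup (at_right 0) (\<lambda>h. (U u - U (S h u)) / ereal h)"

abbreviation is_min_point :: "('a \<Rightarrow> ereal) \<Rightarrow> 'a \<Rightarrow> bool" where
  "is_min_point F u \<equiv> is_arg_min F (\<lambda>_. True) u"

end

theory Submission
  imports Defs
begin

text \<open>
  Both energy estimates come from testing the minimality of \<open>U\<^sup>n\<close> against the flow of \<open>V\<close> started
  at \<open>U\<^sup>n\<close>. Comparing \<open>U\<^sup>n\<close> with its image under the flow for a short time \<open>h\<close> bounds the
  dissipation of \<open>U\<close> by \<open>1 / (2\<tau>\<^sub>n)\<close> times the upper right derivative at time zero of the squared
  distance to \<open>U\<^sup>n\<^sup>-\<^sup>1\<close>. The evolution variational inequality bounds that derivative by
  \<open>2 (V(U\<^sup>n\<^sup>-\<^sup>1) - V(U\<^sup>n))\<close> up to the \<open>\<kappa>\<close>-term, and this is the first claim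
  (\<open>minimizing_step_decreases\<close>).

  For the decay rates, write \<open>\<sigma>\<close> for the slope of \<open>V\<close>. Three facts on the flow are needed: it moves
  at initial speed \<open>\<sigma>\<close> (\<open>flow_dist_le_slope\<close>, \<open>slope_le_flow_speed\<close>); along it the slope decreases
  like \<open>exp (-\<kappa>t)\<close>, which is the infinitesimal form of contraction (\<open>flow_contraction\<close>,
  \<open>slope_flow_le\<close>); and \<open>V\<close> decreases at initial rate \<open>\<sigma>\<^sup>2\<close> (\<open>energy_dissipation_at_0\<close>). If
  \<open>U = \<sigma>\<^sup>2 + 2(\<theta> - \<kappa>)V\<close>, the dissipation of \<open>U\<close> is therefore at least
  \<open>2\<kappa>\<sigma>\<^sup>2 + 2(\<theta> - \<kappa>)\<sigma>\<^sup>2 = 2\<theta>\<sigma>\<^sup>2\<close> (\<open>dissipation_ge\<close>). By \<open>\<kappa>\<close>-convexity \<open>\<sigma>\<^sup>2 \<ge> 2\<kappa>(V - min V)\<close>, so the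
  first claim becomes the decay of \<open>V\<close>. By convexity and completeness \<open>V\<close> has a unique minimum point
  (\<open>convex_ex1_minimizer\<close>). Applied to a minimizing step started from this point, the same estimate shows that this point does not move; so it lies in the domain of \<open>U\<close>,
  and \<open>U = \<sigma>\<^sup>2 + 2(\<theta> - \<kappa>)V\<close> is smallest exactly there.

  For the decay of \<open>U\<close>, the lower bound \<open>2\<theta>\<sigma>\<^sup>2\<close> and the speed bound \<open>\<sigma>\<close> show that a minimizing step
  of size \<open>r\<close> has length at least \<open>2\<theta>\<sigma>r\<close>, with \<open>\<sigma>\<close> taken at its end point, where moreover
  \<open>min \<kappa> \<theta> (U - min U) \<le> \<theta>\<sigma>\<^sup>2\<close> (\<open>U_gap\<close>). Using this only for \<open>r = \<tau>\<^sub>n\<close> gives half of the rate. The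
  other half comes from De Giorgi's variational interpolation, that is, from the minimizing steps of
  all smaller sizes \<open>r\<close> out of the same point: the minimal value of the penalized functional has
  \<open>r\<close>-derivative \<open>-d\<^sup>2 / (2r\<^sup>2)\<close>, where \<open>d\<close> is the length of the step of size \<open>r\<close>
  (\<open>variational_interpolation_decay\<close>).
\<close>

section \<open>Comparison for upper right derivatives\<close>

lemma upper_right_deriv_lessD:
  assumes "upper_right_deriv f t < ereal c"
  shows "\<forall>\<^sub>F h in at_right 0. f (t + h) - f t < c * h"
proof -
  have "\<forall>\<^sub>F h in at_right 0. ereal ((f (t + h) - f t) / h) < ereal c"
    using assms unfolding upper_right_deriv_def by (rule Limsup_lessD)
  moreover have "\<forall>\<^sub>F h in at_right (0::real). 0 < h"
    by (simp add: eventually_at_right_less)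
  ultimately show ?thesis
    by eventually_elim (simp add: field_simps)
qed

text \<open>
  If \<open>f\<close> ended above \<open>g\<close>, consider the last time at which the two functions meet: there \<open>f\<close> grows
  strictly slower than \<open>g\<close>, so it drops below \<open>g\<close> and would have to meet it again. The strict
  inequality of the derivatives is required at meeting points only, so it may be checked with the
  value of \<open>g\<close> in place of that of \<open>f\<close>.
\<close>
lemma comparison_upper_right_deriv:
  fixes f g g' :: "real \<Rightarrow> real"
  assumes "a \<le> b" and cf: "continuous_on {a..b} f"
    and init: "f a \<le> g a"
    and dg: "\<And>t. a \<le> t \<Longrightarrow> t \<le> b \<Longrightarrow> (g has_real_derivative g' t) (at t)"
    and less: "\<And>t. a \<le> t \<Longrightarrow> t < b \<Longrightarrow> f t = g t \<Longrightarrow> upper_right_deriv f t < ereal (g' t)"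
  shows "f b \<le> g b"
proof (rule ccontr)
  assume "\<not> f b \<le> g b"
  then have fb: "f b - g b > 0" by simp
  have "continuous_on {a..b} g"
    using dg by (intro continuous_at_imp_continuous_on ballI DERIV_isCont) auto
  then have cfg: "continuous_on {a..b} (\<lambda>t. f t - g t)"
    by (intro continuous_on_diff cf)
  define Z where "Z = {t\<in>{a..b}. f t - g t = 0}"
  have "closed Z"
    unfolding Z_def by (rule continuous_closed_preimage_constant[OF cfg]) simp
  moreover have "Z \<noteq> {}"
    using IVT'[of "\<lambda>t. f t - g t" a 0 b, OF _ _ \<open>a \<le> b\<close> cfg] init fb
    by (auto simp: Z_def)
  moreover have bdd: "bdd_above Z" by (auto simp: Z_def)
  ultimately have SZ: "Sup Z \<in> Z" by (intro closed_contains_Sup)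
  define s where "s = Sup Z"
  have s: "a \<le> s" "s \<le> b" "f s = g s" using SZ by (auto simp: s_def Z_def)
  have "s < b" using s fb by (cases "s = b") auto
  obtain c where c: "upper_right_deriv f s < ereal c" "c < g' s"
    using ereal_dense2[OF less[OF s(1) \<open>s < b\<close> s(3)]] by auto
  have "((\<lambda>h. (g (s + h) - g s) / h) \<longlongrightarrow> g' s) (at_right 0)"
    using dg[OF s(1,2)] unfolding DERIV_def by (rule tendsto_mono[rotated]) (simp add: at_le)
  then have "\<forall>\<^sub>F h in at_right 0. (g (s + h) - g s) / h > c"
    using c(2) by (rule order_tendstoD)
  moreover have "\<forall>\<^sub>F h in at_right (0::real). h \<in> {0<..<b - s}"
    using \<open>s < b\<close> by (intro eventually_at_rightI[of 0 "b - s"]) auto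
  moreover note upper_right_deriv_lessD[OF c(1)]
  ultimately have "\<forall>\<^sub>F h in at_right 0. h > 0 \<and> s + h < b \<and> f (s + h) < g (s + h)"
    by eventually_elim (use s in \<open>auto simp: field_simps\<close>)
  then obtain h where h: "h > 0" "s + h < b" "f (s + h) < g (s + h)"
    using eventually_happens'[OF trivial_limit_at_right_real] by blast
  have "continuous_on {s + h..b} (\<lambda>t. f t - g t)"
    using s h by (intro continuous_on_subset[OF cfg]) auto
  then obtain r where "s + h \<le> r" "r \<le> b" "f r - g r = 0"
    using IVT'[of "\<lambda>t. f t - g t" "s + h" 0 b] h fb by auto
  then have "r \<in> Z" using s h by (auto simp: Z_def)
  then have "r \<le> s" unfolding s_def by (rule cSup_upper[OF _ bdd])
  with \<open>s + h \<le> r\<close> h show False by simp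
qed

lemma gronwall_upper_right_deriv:
  fixes f :: "real \<Rightarrow> real"
  assumes "0 \<le> T" "B \<noteq> 0" and cf: "continuous_on {0..T} f"
    and D: "\<And>t. 0 \<le> t \<Longrightarrow> t < T \<Longrightarrow> upper_right_deriv f t \<le> ereal (A - B * f t)"
  shows "f T \<le> exp (- B * T) * f 0 + A * ((1 - exp (- B * T)) / B)"
proof -
  define q where "q = exp (- B * T)"
  (* The comparison function solves g' = A + e - B g; the e makes the inequality strict. *)
  have *: "f T \<le> q * f 0 + (A + e) * ((1 - q) / B)" if "e > 0" for e
  proof -
    have "f T \<le> exp (- B * T) * f 0 + (A + e) * ((1 - exp (- B * T)) / B)"
    proof (rule comparison_upper_right_deriv[where a = 0 and b = T and f = f and
          g = "\<lambda>t. exp (- B * t) * f 0 + (A + e) * ((1 - exp (- B * t)) / B)" and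
          g' = "\<lambda>t. - B * exp (- B * t) * f 0 + (A + e) * exp (- B * t)"])
      fix t assume t: "0 \<le> t" "t < T"
        and eq: "f t = exp (- B * t) * f 0 + (A + e) * ((1 - exp (- B * t)) / B)"
      have "B * f t = B * exp (- B * t) * f 0 + (A + e) * (1 - exp (- B * t))"
        unfolding eq using \<open>B \<noteq> 0\<close> by (simp add: distrib_left)
      then have "A - B * f t < - B * exp (- B * t) * f 0 + (A + e) * exp (- B * t)"
        using \<open>e > 0\<close> by (simp add: algebra_simps)
      then show "upper_right_deriv f t < ereal (- B * exp (- B * t) * f 0 + (A + e) * exp (- B * t))"
        using D[OF t] by (meson le_less_trans less_ereal.simps(1))
    qed (use assms in \<open>auto intro!: derivative_eq_intros\<close>)
    then show ?thesis by (simp add: q_def)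
  qed
  have "((\<lambda>e. q * f 0 + (A + e) * ((1 - q) / B)) \<longlongrightarrow> q * f 0 + (A + 0) * ((1 - q) / B)) (at_right 0)"
    by (intro tendsto_intros)
  moreover have "\<forall>\<^sub>F e in at_right 0. f T \<le> q * f 0 + (A + e) * ((1 - q) / B)"
    using * by (intro eventually_at_rightI[of 0 1]) auto
  ultimately show ?thesis
    unfolding q_def by (intro tendsto_lowerbound[where F = "at_right 0"]) auto
qed

text \<open>
  For every \<open>n\<close>, the set of times near which the oscillation of \<open>f\<close> is below \<open>1 / (n + 1)\<close> is open, and
  it is dense because a right neighbourhood of any time contains such times. Continuity points are
  the common elements of these sets, which exist by Baire's theorem.
\<close>
lemma right_continuous_imp_ex_isCont:
  fixes f :: "real \<Rightarrow> 'a::metric_space"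
  assumes rc: "\<And>t. (f \<longlongrightarrow> f t) (at_right t)" and "a < b"
  shows "\<exists>t\<in>{a<..<b}. isCont f t"
proof -
  define G where "G n = {t. \<exists>d>0. \<forall>r\<in>ball t d. \<forall>s\<in>ball t d. dist (f r) (f s) < 1 / real (Suc n)}" for n
  have "open (G n)" for n
  proof (rule openI)
    fix t assume "t \<in> G n"
    then obtain d where d: "d > 0" "\<forall>r\<in>ball t d. \<forall>s\<in>ball t d. dist (f r) (f s) < 1 / real (Suc n)"
      by (auto simp: G_def)
    have "x \<in> G n" if "x \<in> ball t (d/2)" for x
    proof -
      have "ball x (d/2) \<subseteq> ball t d"
      proof
        fix y assume "y \<in> ball x (d/2)"
        then show "y \<in> ball t d" using that dist_triangle[of t y x] by simp
      qed
      then show ?thesis using d unfolding G_def by (auto intro!: exI[of _ "d/2"])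
    qed
    then show "\<exists>e>0. ball t e \<subseteq> G n" using \<open>d > 0\<close> by (intro exI[of _ "d/2"]) auto
  qed
  moreover have dense: "\<exists>t\<in>{x<..<y}. t \<in> G n" if "x < y" for x y n
  proof -
    define z where "z = (x + y) / 2"
    have z: "x < z" "z < y" using that by (auto simp: z_def)
    have "\<forall>\<^sub>F r in at_right z. dist (f r) (f z) < 1 / real (Suc n) / 2"
      using rc[of z] by (rule tendstoD) simp
    then obtain e where e: "e > z" "\<And>r. z < r \<Longrightarrow> r < e \<Longrightarrow> dist (f r) (f z) < 1 / real (Suc n) / 2"
      unfolding eventually_at_right_field by blast
    define m where "m = min e y"
    have m: "z < m" "m \<le> e" "m \<le> y" using e z by (auto simp: m_def)
    define t where "t = (z + m) / 2"
    have "dist (f r) (f s) < 1 / real (Suc n)" if "r \<in> ball t ((m - z)/2)" "s \<in> ball t ((m - z)/2)" for r s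
    proof -
      have "z < r" "r < e" "z < s" "s < e"
        using that m by (auto simp: t_def dist_real_def abs_less_iff field_simps)
      then have "dist (f r) (f z) < 1 / real (Suc n) / 2" "dist (f s) (f z) < 1 / real (Suc n) / 2"
        using e by auto
      moreover have "dist (f r) (f s) \<le> dist (f r) (f z) + dist (f s) (f z)"
        by (rule dist_triangle2)
      ultimately show ?thesis by linarith
    qed
    then have "t \<in> G n" using m unfolding G_def by (auto intro!: exI[of _ "(m - z)/2"])
    then show ?thesis using m z by (intro bexI[of _ t]) (auto simp: t_def)
  qed
  have "closure (G n) = UNIV" for n
  proof -
    have "t \<in> closure (G n)" for t
      unfolding closure_approachable
    proof (intro allI impI)
      fix e :: real assume "e > 0"
      then obtain s where "s \<in> {t<..<t+e}" "s \<in> G n" using dense[of t "t + e" n] by auto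
      then show "\<exists>s\<in>G n. dist s t < e" by (intro bexI[of _ s]) (auto simp: dist_real_def)
    qed
    then show ?thesis by blast
  qed
  ultimately have "UNIV \<subseteq> closure (\<Inter> (range G))"
    by (intro Baire) auto
  then have "(a + b) / 2 \<in> closure (\<Inter> (range G))" by blast
  then obtain t where t: "t \<in> \<Inter> (range G)" "dist t ((a + b) / 2) < (b - a) / 2"
    unfolding closure_approachable using \<open>a < b\<close> by (metis diff_gt_0_iff_gt half_gt_zero)
  have "isCont f t"
    unfolding continuous_at_eps_delta
  proof (intro allI impI)
    fix e :: real assume "e > 0"
    then obtain n where n: "1 / real (Suc n) < e" using nat_approx_posE by metis
    obtain d where d: "d > 0" "\<forall>r\<in>ball t d. \<forall>s\<in>ball t d. dist (f r) (f s) < 1 / real (Suc n)"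
      using t(1) unfolding G_def by blast
    then have "\<forall>r. dist r t < d \<longrightarrow> dist (f r) (f t) < e"
      using n by (metis centre_in_ball dist_commute less_trans mem_ball)
    then show "\<exists>d>0. \<forall>r. dist r t < d \<longrightarrow> dist (f r) (f t) < e" using d by blast
  qed
  moreover have "t \<in> {a<..<b}"
    using t(2) by (auto simp: dist_real_def abs_less_iff field_simps)
  ultimately show ?thesis by blast
qed

section \<open>Sublevels and minimizers of lower semicontinuous convex functionals\<close>

lemma lower_semicontinuous_eventually_greater:
  assumes "lower_semicontinuous F" "c < F x"
  shows "\<forall>\<^sub>F y in nhds x. c < F y"
proof -
  have "c < Liminf (at x) F"
    using assms unfolding lower_semicontinuous_def by (meson less_le_trans)
  then have "\<forall>\<^sub>F y in at x. c < F y" by (rule less_LiminfD)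
  then show ?thesis using assms(2) by (simp add: eventually_nhds_conv_at)
qed

lemma lower_semicontinuous_closed_sublevel:
  assumes "lower_semicontinuous F"
  shows "closed {x. F x \<le> c}"
proof -
  have "open {x. c < F x}"
    unfolding open_subopen[of "{x. c < F x}"]
  proof
    fix x assume "x \<in> {x. c < F x}"
    then have "\<forall>\<^sub>F y in nhds x. c < F y"
      using lower_semicontinuous_eventually_greater[OF assms] by simp
    then show "\<exists>T. open T \<and> x \<in> T \<and> T \<subseteq> {x. c < F x}"
      unfolding eventually_nhds by blast
  qed
  moreover have "- {x. c < F x} = {x. F x \<le> c}" by auto
  ultimately show ?thesis by (metis closed_open double_complement)
qed

text \<open>
  The midpoint of a geodesic between two almost minimizers would otherwise have too small a value.
\<close>
lemma dist_le_of_almost_min: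
  assumes conv: "geodesically_convex \<kappa> V" and lower: "\<And>w. ereal b \<le> V w"
    and xy: "V x \<le> ereal (b + e)" "V y \<le> ereal (b + e)"
  shows "\<kappa> / 8 * (dist x y)\<^sup>2 \<le> e"
proof -
  have "x \<in> Dom V" "y \<in> Dom V" using xy by (auto simp: Dom_def)
  then obtain c :: "real \<Rightarrow> 'a" where c: "\<And>s. s \<in> {0..1} \<Longrightarrow> V (c s) \<le> ereal (1 - s) * V x + ereal s * V y - ereal (\<kappa> / 2 * s * (1 - s) * (dist x y)\<^sup>2)"
    using conv unfolding geodesically_convex_def by metis
  obtain p q where "V x = ereal p" "V y = ereal q"
    using xy lower[of x] lower[of y] by (cases "V x"; cases "V y") auto
  with xy c[of "1/2"] order_trans[OF lower c[of "1/2"]] show ?thesis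
    by (simp add: field_simps)
qed

text \<open>
  Lower semicontinuity bounds \<open>V\<close> below by \<open>a - 1\<close> on a small ball around a point \<open>z\<close> of value \<open>a\<close>.
  A geodesic from \<open>z\<close> to a distant point \<open>w\<close> at distance \<open>d\<close> spends an initial part of relative length
  \<open>r / (2d)\<close> in that ball, and convexity propagates the bound from there to \<open>w\<close>; the loss is linear
  in \<open>d\<close> and the gain from \<open>\<kappa>\<close> is quadratic.
\<close>
lemma convex_bounded_below:
  assumes conv: "geodesically_convex \<kappa> V" and "0 < \<kappa>" and lsc: "lower_semicontinuous V"
    and neq: "\<And>w. V w \<noteq> -\<infinity>" and "Dom V \<noteq> {}"
  shows "\<exists>b. \<forall>w. ereal b \<le> V w"
proof -
  obtain z a where z: "z \<in> Dom V" "V z = ereal a"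
  proof -
    obtain z where "z \<in> Dom V" using \<open>Dom V \<noteq> {}\<close> by blast
    then show ?thesis using neq[of z] that[of z] by (cases "V z") (auto simp: Dom_def)
  qed
  have "\<forall>\<^sub>F w in nhds z. ereal (a - 1) < V w"
    using z by (intro lower_semicontinuous_eventually_greater[OF lsc]) simp
  then obtain r where r: "0 < r" "\<And>w. dist w z < r \<Longrightarrow> ereal (a - 1) < V w"
    unfolding eventually_nhds_metric by blast
  have "ereal (a - 1 - 4 / (\<kappa> * r\<^sup>2)) \<le> V w" for w
  proof (cases "V w")
    case (real b)
    define d where "d = dist z w"
    have pos: "0 \<le> 4 / (\<kappa> * r\<^sup>2)" using \<open>0 < \<kappa>\<close> by simp
    show ?thesis
    proof (cases "d < r")
      case True
      then have "a - 1 < b" using r(2)[of w] real by (simp add: d_def dist_commute)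
      with pos have "a - 1 - 4 / (\<kappa> * r\<^sup>2) \<le> b" by linarith
      then show ?thesis using real by simp
    next
      case False
      then have d: "r \<le> d" "0 < d" using r by auto
      define s where "s = r / (2 * d)"
      have s: "0 < s" "s \<le> 1 / 2" using d r by (auto simp: s_def field_simps)
      have wD: "w \<in> Dom V" using real by (simp add: Dom_def)
      obtain c where c: "c 0 = z" "\<And>s r. s \<in> {0..1} \<Longrightarrow> r \<in> {0..1} \<Longrightarrow> dist (c s) (c r) \<le> \<bar>s - r\<bar> * d"
          "\<And>s. s \<in> {0..1} \<Longrightarrow> V (c s) \<le> ereal (1 - s) * V z + ereal s * V w - ereal (\<kappa> / 2 * s * (1 - s) * d\<^sup>2)"
        using conv z(1) wD unfolding geodesically_convex_def d_def by metis
      have "dist (c s) z \<le> s * d" using c(2)[of s 0] c(1) s by simp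
      also have "\<dots> < r" using d r by (simp add: s_def)
      finally have "ereal (a - 1) < V (c s)" by (rule r(2))
      also have "\<dots> \<le> ereal (1 - s) * V z + ereal s * V w - ereal (\<kappa> / 2 * s * (1 - s) * d\<^sup>2)"
        using c(3)[of s] s by simp
      finally have "a - 1 < (1 - s) * a + s * b - \<kappa> / 2 * s * (1 - s) * d\<^sup>2"
        using z real by simp
      then have "s * (a - 1 / s + \<kappa> / 2 * (1 - s) * d\<^sup>2) < s * b"
        using s by (simp add: algebra_simps)
      then have "a - 1 / s + \<kappa> / 2 * (1 - s) * d\<^sup>2 < b" using s by simp
      moreover have "\<kappa> / 2 * (1 / 2) * d\<^sup>2 \<le> \<kappa> / 2 * (1 - s) * d\<^sup>2"
        using s \<open>0 < \<kappa>\<close> by (intro mult_right_mono mult_left_mono) auto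
      moreover have "1 / s = 2 * d / r" by (simp add: s_def)
      moreover have "\<kappa> / 4 * d\<^sup>2 - 2 * d / r + 4 / (\<kappa> * r\<^sup>2) = (\<kappa> * r * d - 4)\<^sup>2 / (4 * \<kappa> * r\<^sup>2)"
        using r \<open>0 < \<kappa>\<close> by (simp add: field_simps power2_eq_square)
      moreover have "0 \<le> (\<kappa> * r * d - 4)\<^sup>2 / (4 * \<kappa> * r\<^sup>2)" using \<open>0 < \<kappa>\<close> by simp
      ultimately have "a - 4 / (\<kappa> * r\<^sup>2) \<le> b" by simp
      then show ?thesis using real by simp
    qed
  qed (use neq in auto)
  then show ?thesis by blast
qed

text \<open>
  Sublevels slightly above the infimum are closed, nested and of vanishing diameter.
\<close>
lemma convex_ex1_minimizer:
  fixes V :: "'a::complete_space \<Rightarrow> ereal"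
  assumes conv: "geodesically_convex \<kappa> V" and "0 < \<kappa>" and lsc: "lower_semicontinuous V"
    and neq: "\<And>w. V w \<noteq> -\<infinity>" and "Dom V \<noteq> {}"
  obtains m where "m \<in> Dom V" "\<And>w. V m \<le> V w" "\<And>w. V w \<le> V m \<Longrightarrow> w = m"
proof -
  obtain b0 where b0: "\<And>w. ereal b0 \<le> V w" using convex_bounded_below[OF assms] by blast
  obtain z where z: "V z < \<infinity>" using \<open>Dom V \<noteq> {}\<close> by (auto simp: Dom_def)
  have Inf_le: "(INF w. V w) \<le> V z" by (rule INF_lower) simp
  have "ereal b0 \<le> (INF w. V w)" using b0 by (intro INF_greatest)
  then obtain b where b: "(INF w. V w) = ereal b"
    using Inf_le z by (cases "INF w. V w") auto
  have lower: "ereal b \<le> V w" for w unfolding b[symmetric] by (rule INF_lower) simp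
  define C where "C n = {w. V w \<le> ereal (b + 1 / real (Suc n))}" for n
  have "\<exists>m. \<Inter> (range C) = {m}"
  proof (rule decreasing_closed_nest_sing)
    show "closed (C n)" for n
      unfolding C_def by (rule lower_semicontinuous_closed_sublevel[OF lsc])
    show "C n \<noteq> {}" for n
    proof -
      have "(INF w. V w) < ereal (b + 1 / real (Suc n))" unfolding b by simp
      then show ?thesis unfolding C_def INF_less_iff by (auto intro: less_imp_le)
    qed
    show "C n \<subseteq> C k" if "k \<le> n" for k n
    proof
      fix w assume "w \<in> C n"
      then have "V w \<le> ereal (b + 1 / real (Suc n))" by (simp add: C_def)
      also have "\<dots> \<le> ereal (b + 1 / real (Suc k))" using that by (simp add: frac_le)
      finally show "w \<in> C k" by (simp add: C_def)
    qed
    show "\<exists>n. \<forall>x\<in>C n. \<forall>y\<in>C n. dist x y < e" if "0 < e" for e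
    proof -
      obtain n where n: "1 / real (Suc n) < \<kappa> / 8 * e\<^sup>2"
        using nat_approx_posE[of "\<kappa> / 8 * e\<^sup>2"] \<open>0 < e\<close> \<open>0 < \<kappa>\<close> by auto
      have "dist x y < e" if "x \<in> C n" "y \<in> C n" for x y
      proof -
        have "\<kappa> / 8 * (dist x y)\<^sup>2 \<le> 1 / real (Suc n)"
          using that by (intro dist_le_of_almost_min[OF conv lower]) (auto simp: C_def)
        with n have "\<kappa> / 8 * (dist x y)\<^sup>2 < \<kappa> / 8 * e\<^sup>2" by linarith
        then have "(dist x y)\<^sup>2 < e\<^sup>2" using \<open>0 < \<kappa>\<close> by simp
        then show ?thesis using \<open>0 < e\<close> power2_less_imp_less by (metis less_imp_le)
      qed
      then show ?thesis by blast
    qed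
  qed
  then obtain m where "m \<in> \<Inter> (range C)" by blast
  then have m: "V m \<le> ereal (b + 1 / real (Suc n))" for n unfolding C_def by blast
  have "V m \<le> ereal b"
  proof (rule ereal_le_epsilon2)
    fix e :: real assume "0 < e"
    then obtain n where "1 / real (Suc n) < e" using nat_approx_posE by metis
    then have "ereal (b + 1 / real (Suc n)) \<le> ereal b + ereal e" by simp
    with m[of n] show "V m \<le> ereal b + ereal e" by (rule order_trans)
  qed
  with lower have Vm: "V m = ereal b" by (intro antisym)
  show ?thesis
  proof (rule that)
    show "m \<in> Dom V" using Vm by (simp add: Dom_def)
    show "V m \<le> V w" for w using lower Vm by simp
    show "w = m" if "V w \<le> V m" for w
      using dist_le_of_almost_min[OF conv lower, of w 0 m] that Vm \<open>0 < \<kappa>\<close>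
      by (simp add: mult_le_0_iff)
  qed
qed

section \<open>Flows and minimizing steps\<close>

locale evi_flow =
  fixes V :: "'a::metric_space \<Rightarrow> ereal" and S :: "real \<Rightarrow> 'a \<Rightarrow> 'a" and \<kappa> :: real
  assumes V_neq_MInf: "V w \<noteq> -\<infinity>"
    and lsc: "lower_semicontinuous V"
    and flow: "is_flow \<kappa> V S"
begin

abbreviation W :: "'a \<Rightarrow> real" where "W w \<equiv> real_of_ereal (V w)"

lemma V_realE:
  assumes "w \<in> Dom V"
  obtains a where "V w = ereal a"
  using V_neq_MInf[of w] assms by (cases "V w") (auto simp: Dom_def)

lemma ereal_W: "w \<in> Dom V \<Longrightarrow> ereal (W w) = V w"
  by (erule V_realE) simp

lemma flow_in_Dom: "u \<in> Dom V \<Longrightarrow> 0 \<le> t \<Longrightarrow> S t u \<in> Dom V"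
  and continuous_on_flow_map: "0 \<le> t \<Longrightarrow> continuous_on (Dom V) (S t)"
  and flow_flow: "u \<in> Dom V \<Longrightarrow> 0 \<le> t \<Longrightarrow> 0 \<le> h \<Longrightarrow> S h (S t u) = S (t + h) u"
  and flow_tendsto_id: "u \<in> Dom V \<Longrightarrow> ((\<lambda>h. S h u) \<longlongrightarrow> u) (at_right 0)"
  using flow unfolding is_flow_def by auto

lemma flow_0: assumes "u \<in> Dom V" shows "S 0 u = u"
proof -
  have "((\<lambda>h. S h (S 0 u)) \<longlongrightarrow> S 0 u) (at_right 0)"
    using flow_in_Dom[OF assms] by (intro flow_tendsto_id) simp
  moreover have "\<forall>\<^sub>F h in at_right 0. S h (S 0 u) = S h u"
    using flow_flow[OF assms, of 0] by (intro eventually_at_rightI[of 0 1]) simp_all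
  ultimately have "((\<lambda>h. S h u) \<longlongrightarrow> S 0 u) (at_right 0)"
    by (rule Lim_transform_eventually)
  from tendsto_unique[OF trivial_limit_at_right_real this flow_tendsto_id[OF assms]]
  show ?thesis .
qed

lemma flow_right_continuous:
  assumes "u \<in> Dom V" "0 \<le> t"
  shows "((\<lambda>r. S r u) \<longlongrightarrow> S t u) (at_right t)"
proof -
  have "((\<lambda>h. S h (S t u)) \<longlongrightarrow> S t u) (at_right 0)"
    using assms by (intro flow_tendsto_id flow_in_Dom)
  moreover have "\<forall>\<^sub>F h in at_right 0. S h (S t u) = S (h + t) u"
    using flow_flow[OF assms] by (intro eventually_at_rightI[of 0 1]) (simp_all add: add.commute)
  ultimately have "((\<lambda>h. S (h + t) u) \<longlongrightarrow> S t u) (at_right 0)"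
    by (rule Lim_transform_eventually)
  then show ?thesis
    using filterlim_at_right_to_0[of "\<lambda>r. S r u" "nhds (S t u)" t] by simp
qed

text \<open>
  Right continuity is the semigroup law combined with continuity at time zero. For left continuity
  at \<open>t\<close>, take a continuity point \<open>r < t\<close> of the trajectory, which a right continuous function has,
  and transport it by the continuous map \<open>S (t - r)\<close>.
\<close>
lemma continuous_on_flow:
  assumes "u \<in> Dom V"
  shows "continuous_on {0..} (\<lambda>t. S t u)"
  unfolding continuous_on_eq_continuous_within
proof
  fix t :: real assume "t \<in> {0..}"
  then have "t \<ge> 0" by simp
  (* Extending the trajectory by a constant makes it right continuous on the whole line. *)
  define f where "f r = (if r \<le> 0 then u else S r u)" for r
  have f_eq: "f r = S r u" if "r \<ge> 0" for r
    using that flow_0[OF assms] by (auto simp: f_def)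
  have rc: "(f \<longlongrightarrow> f r) (at_right r)" for r
  proof (cases "r < 0")
    case True
    have "\<forall>\<^sub>F s in at_right r. f r = f s"
      using True by (intro eventually_at_rightI[of r 0]) (auto simp: f_def)
    then show ?thesis
      by (rule Lim_transform_eventually[OF tendsto_const])
  next
    case False
    then have "\<forall>\<^sub>F s in at_right r. S s u = f s"
      by (intro eventually_at_rightI[of r "r + 1"]) (auto simp: f_eq)
    with False show ?thesis
      using Lim_transform_eventually[OF flow_right_continuous[OF assms, of r]] by (simp add: f_eq)
  qed
  show "continuous (at t within {0..}) (\<lambda>t. S t u)"
  proof (cases "t = 0")
    case True
    have "at t within {0..} = at_right t"
      unfolding True by (rule at_within_Ici_at_right)
    with flow_right_continuous[OF assms \<open>t \<ge> 0\<close>] show ?thesis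
      by (simp add: continuous_within)
  next
    case False
    with \<open>t \<ge> 0\<close> have "0 < t" by simp
    then obtain r where r: "0 < r" "r < t" "isCont f r"
      using right_continuous_imp_ex_isCont[of f 0 t] rc by auto
    have limf: "((\<lambda>s. f (s - (t - r))) \<longlongrightarrow> f r) (at t)"
      by (rule isCont_tendsto_compose[OF r(3)]) (auto intro!: tendsto_eq_intros)
    have cont: "continuous (at (f r) within Dom V) (S (t - r))"
      using continuous_on_flow_map[of "t - r"] r flow_in_Dom[OF assms, of r]
      by (simp add: continuous_on_eq_continuous_within f_eq)
    have ev: "\<forall>\<^sub>F s in at t. s > t - r"
      using r by (intro eventually_at_topological[THEN iffD2] exI[of _ "{t - r<..}"]) auto
    then have inDom: "\<forall>\<^sub>F s in at t. f (s - (t - r)) \<in> Dom V"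
      by eventually_elim (use flow_in_Dom[OF assms] in \<open>auto simp: f_eq\<close>)
    note lim = continuous_within_tendsto_compose[OF cont inDom limf]
    have eq: "\<forall>\<^sub>F s in at t. S (t - r) (f (s - (t - r))) = S s u"
    proof (rule eventually_mono[OF ev])
      fix s assume "t - r < s"
      then show "S (t - r) (f (s - (t - r))) = S s u"
        using flow_flow[OF assms, of "s - (t - r)" "t - r"] r by (simp add: f_eq)
    qed
    have "S (t - r) (f r) = S t u"
      using flow_flow[OF assms, of r "t - r"] r by (simp add: f_eq)
    then have "((\<lambda>s. S s u) \<longlongrightarrow> S t u) (at t)"
      using Lim_transform_eventually[OF lim eq] by simp
    then show ?thesis
      unfolding continuous_within by (rule tendsto_within_subset) simp
  qed
qed

text \<open>
  The evolution variational inequality between finite values, so that it can be rearranged.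
\<close>
lemma evi:
  assumes "u \<in> Dom V" "v \<in> Dom V" "0 \<le> t"
  shows "upper_right_deriv (\<lambda>r. (dist (S r u) v)\<^sup>2) t
           \<le> ereal (2 * (W v - W (S t u)) - \<kappa> * (dist (S t u) v)\<^sup>2)"
proof -
  define D where "D = upper_right_deriv (\<lambda>r. (dist (S r u) v)\<^sup>2) t"
  have "ereal (1 / 2) * D + ereal (\<kappa> / 2 * (dist (S t u) v)\<^sup>2) + ereal (W (S t u)) \<le> ereal (W v)"
  proof -
    have "ereal (1 / 2) * D + ereal (\<kappa> / 2 * (dist (S t u) v)\<^sup>2) + V (S t u) \<le> V v"
      using flow assms unfolding is_flow_def D_def by blast
    then show ?thesis
      using assms by (simp add: ereal_W flow_in_Dom)
  qed
  then show ?thesis unfolding D_def[symmetric] by (cases D) (auto simp: field_simps)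
qed

text \<open>
  Only points of finite energy matter: where \<open>V\<close> is infinite the difference quotient is zero.
\<close>
lemma slope_leI:
  assumes z: "z \<in> Dom V" and "0 \<le> L" and bound: "\<And>v. v \<in> Dom V \<Longrightarrow> W z - W v \<le> L * dist z v"
  shows "slope V z \<le> ereal L"
proof -
  have "max 0 (V z - V v) / ereal (dist z v) \<le> ereal L" if "v \<noteq> z" for v
  proof (cases "v \<in> Dom V")
    case True
    have "max 0 (ereal (W z) - ereal (W v)) / ereal (dist z v) \<le> ereal L"
      using bound[OF True] that \<open>0 \<le> L\<close> by (auto simp: max_def field_simps)
    then show ?thesis by (simp only: ereal_W z True)
  next
    case False
    then have "V v = \<infinity>" by (simp add: Dom_def)
    then show ?thesis using z that \<open>0 \<le> L\<close>
      by (cases "V z") (auto simp: Dom_def max_def zero_ereal_def)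
  qed
  then have "\<forall>\<^sub>F v in at z. max 0 (V z - V v) / ereal (dist z v) \<le> ereal L"
    by (auto simp: eventually_at_filter)
  then have "Limsup (at z) (\<lambda>v. max 0 (V z - V v) / ereal (dist z v)) \<le> ereal L"
    by (rule Limsup_bounded)
  then show ?thesis using \<open>0 \<le> L\<close> by (simp add: slope_def)
qed

text \<open>
  The minimizer \<open>m\<close> is compared with its image under the flow; if that image leaves the domain
  of \<open>U\<close>, the corresponding quotient is minus infinity.
\<close>
lemma dissipation_le_distance_deriv:
  assumes m: "m \<in> Dom U" "m \<in> Dom V" and U_neq: "\<And>w. U w \<noteq> -\<infinity>" and "0 < \<sigma>"
    and min: "\<And>w. w \<in> Dom U \<Longrightarrow> ereal (1 / (2 * \<sigma>) * (dist m y)\<^sup>2) + U m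
                   \<le> ereal (1 / (2 * \<sigma>) * (dist w y)\<^sup>2) + U w"
  shows "dissipation S U m \<le> ereal (1 / (2 * \<sigma>)) * upper_right_deriv (\<lambda>r. (dist (S r m) y)\<^sup>2) 0"
proof -
  have "\<forall>\<^sub>F h in at_right 0. (U m - U (S h m)) / ereal h
          \<le> ereal (1 / (2 * \<sigma>)) * ereal (((dist (S (0 + h) m) y)\<^sup>2 - (dist (S 0 m) y)\<^sup>2) / h)"
  proof (rule eventually_at_rightI[of 0 1])
    fix h :: real assume "h \<in> {0<..<1}"
    then have h: "h > 0" by simp
    obtain a where a: "U m = ereal a" using m U_neq[of m] by (cases "U m") (auto simp: Dom_def)
    show "(U m - U (S h m)) / ereal h
          \<le> ereal (1 / (2 * \<sigma>)) * ereal (((dist (S (0 + h) m) y)\<^sup>2 - (dist (S 0 m) y)\<^sup>2) / h)"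
    proof (cases "U (S h m)")
      case (real b)
      then have "ereal (1 / (2 * \<sigma>) * (dist m y)\<^sup>2) + ereal a
                   \<le> ereal (1 / (2 * \<sigma>) * (dist (S h m) y)\<^sup>2) + ereal b"
        using min[of "S h m"] a by (simp add: Dom_def)
      then have "a - b \<le> 1 / (2 * \<sigma>) * ((dist (S h m) y)\<^sup>2 - (dist m y)\<^sup>2)"
        by (simp add: right_diff_distrib)
      from divide_right_mono[OF this, of h] h show ?thesis
        using real a flow_0[OF m(2)] by simp
    qed (use a h U_neq[of "S h m"] in auto)
  qed simp
  then have "dissipation S U m \<le> Limsup (at_right 0)
      (\<lambda>h. ereal (1 / (2 * \<sigma>)) * ereal (((dist (S (0 + h) m) y)\<^sup>2 - (dist (S 0 m) y)\<^sup>2) / h))"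
    unfolding dissipation_def by (rule Limsup_mono)
  also have "\<dots> = ereal (1 / (2 * \<sigma>)) * upper_right_deriv (\<lambda>r. (dist (S r m) y)\<^sup>2) 0"
    unfolding upper_right_deriv_def using \<open>0 < \<sigma>\<close>
    by (intro Limsup_ereal_mult_left) (auto simp: trivial_limit_at_right_real)
  finally show ?thesis .
qed

lemma minimizing_step_decreases:
  assumes m: "m \<in> Dom U" "Dom U \<subseteq> Dom V" and U_neq: "\<And>w. U w \<noteq> -\<infinity>" and "0 < \<sigma>"
    and min: "\<And>w. w \<in> Dom U \<Longrightarrow> ereal (1 / (2 * \<sigma>) * (dist m y)\<^sup>2) + U m
                   \<le> ereal (1 / (2 * \<sigma>) * (dist w y)\<^sup>2) + U w"
  shows "V m + ereal \<sigma> * dissipation S U m + ereal (\<kappa> / 2 * (dist m y)\<^sup>2) \<le> V y"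
proof (cases "y \<in> Dom V")
  case False
  then show ?thesis by (simp add: Dom_def)
next
  case True
  have mV: "m \<in> Dom V" using m by auto
  define D where "D = upper_right_deriv (\<lambda>r. (dist (S r m) y)\<^sup>2) 0"
  have D: "D \<le> ereal (2 * (W y - W m) - \<kappa> * (dist m y)\<^sup>2)"
    using evi[OF mV True, of 0] by (simp add: D_def flow_0 mV)
  have "ereal \<sigma> * dissipation S U m \<le> ereal \<sigma> * (ereal (1 / (2 * \<sigma>)) * D)"
    unfolding D_def using dissipation_le_distance_deriv[OF m(1) mV U_neq \<open>0 < \<sigma>\<close> min] \<open>0 < \<sigma>\<close>
    by (intro ereal_mult_left_mono) auto
  also have "\<dots> = ereal (1 / 2) * D"
    using \<open>0 < \<sigma>\<close> by (simp flip: mult.assoc)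
  also have "\<dots> \<le> ereal (1 / 2) * ereal (2 * (W y - W m) - \<kappa> * (dist m y)\<^sup>2)"
    using D by (intro ereal_mult_left_mono) auto
  finally have *: "ereal \<sigma> * dissipation S U m \<le> ereal (1 / 2) * ereal (2 * (W y - W m) - \<kappa> * (dist m y)\<^sup>2)" .
  obtain a b where "V m = ereal a" "V y = ereal b"
    using V_realE[OF mV] V_realE[OF True] by metis
  with * show ?thesis
    by (cases "ereal \<sigma> * dissipation S U m") (auto simp: field_simps)
qed

end

section \<open>Decay and contraction along a flow with positive convexity parameter\<close>

locale convex_evi_flow = evi_flow +
  assumes convex: "geodesically_convex \<kappa> V" and \<kappa>_pos: "0 < \<kappa>"
begin

text \<open>
  If \<open>V\<close> stayed strictly above its initial value, the evolution variational inequality with the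
  initial point as \<open>v\<close> would keep the trajectory at that point.
\<close>
lemma V_flow_le_somewhere:
  assumes u: "u \<in> Dom V" and "0 < t"
  shows "\<exists>r\<in>{0<..t}. V (S r u) \<le> V u"
proof (rule ccontr)
  assume "\<not> ?thesis"
  then have gt: "V u < V (S r u)" if "0 < r" "r \<le> t" for r using that by force
  have W_le: "W u \<le> W (S r u)" if "0 \<le> r" "r \<le> t" for r
  proof (cases "r = 0")
    case True
    then show ?thesis by (simp add: flow_0[OF u])
  next
    case False
    then have "ereal (W u) < ereal (W (S r u))"
      using gt[of r] that u by (simp only: ereal_W flow_in_Dom)
    then show ?thesis by simp
  qed
  have "(dist (S t u) u)\<^sup>2
      \<le> exp (- \<kappa> * t) * (dist (S 0 u) u)\<^sup>2 + 0 * ((1 - exp (- \<kappa> * t)) / \<kappa>)"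
  proof (rule gronwall_upper_right_deriv[where f = "\<lambda>t. (dist (S t u) u)\<^sup>2"])
    show "continuous_on {0..t} (\<lambda>t. (dist (S t u) u)\<^sup>2)"
      by (intro continuous_intros continuous_on_subset[OF continuous_on_flow[OF u]]) auto
  next
    fix r assume r: "0 \<le> r" "r < t"
    have "2 * (W u - W (S r u)) - \<kappa> * (dist (S r u) u)\<^sup>2 \<le> 0 - \<kappa> * (dist (S r u) u)\<^sup>2"
      using W_le[of r] r by simp
    then show "upper_right_deriv (\<lambda>t. (dist (S t u) u)\<^sup>2) r \<le> ereal (0 - \<kappa> * (dist (S r u) u)\<^sup>2)"
      using evi[OF u u r(1)] by (meson ereal_less_eq(3) order_trans)
  qed (use \<kappa>_pos \<open>0 < t\<close> in auto)
  then have "S t u = u" by (simp add: flow_0[OF u])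
  with gt[of t] \<open>0 < t\<close> show False by simp
qed

text \<open>
  By lower semicontinuity there is a last time up to \<open>t\<close> at which \<open>V\<close> is at most its initial value;
  restarting the flow there produces a later one unless that time is \<open>t\<close>.
\<close>
lemma V_flow_le:
  assumes u: "u \<in> Dom V" and "0 \<le> t"
  shows "V (S t u) \<le> V u"
proof -
  define Z where "Z = {0..t} \<inter> (\<lambda>r. S r u) -` {x. V x \<le> V u}"
  have "closed Z"
    unfolding Z_def
    by (intro continuous_closed_preimage continuous_on_subset[OF continuous_on_flow[OF u]]
        lower_semicontinuous_closed_sublevel lsc) auto
  moreover have "0 \<in> Z" using \<open>0 \<le> t\<close> by (simp add: Z_def flow_0[OF u])
  moreover have bdd: "bdd_above Z" by (auto simp: Z_def)
  ultimately have SZ: "Sup Z \<in> Z" by (intro closed_contains_Sup) auto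
  define s where "s = Sup Z"
  have s: "0 \<le> s" "s \<le> t" "V (S s u) \<le> V u" using SZ by (auto simp: s_def Z_def)
  have "s = t"
  proof (rule ccontr)
    assume "s \<noteq> t"
    with s have "0 < t - s" by simp
    from V_flow_le_somewhere[OF flow_in_Dom[OF u s(1)] this]
    obtain r where r: "0 < r" "r \<le> t - s" "V (S r (S s u)) \<le> V (S s u)" by auto
    then have "V (S (s + r) u) \<le> V u"
      using flow_flow[OF u s(1), of r] s(3) by simp
    then have "s + r \<in> Z" using r s by (auto simp: Z_def)
    then have "s + r \<le> s" unfolding s_def by (rule cSup_upper[OF _ bdd])
    with r show False by simp
  qed
  with s show ?thesis by simp
qed

lemma W_flow_antimono:
  assumes u: "u \<in> Dom V" and "0 \<le> r" "r \<le> t"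
  shows "W (S t u) \<le> W (S r u)"
proof -
  have "ereal (W (S (t - r) (S r u))) \<le> ereal (W (S r u))"
    using V_flow_le[OF flow_in_Dom[OF u \<open>0 \<le> r\<close>], of "t - r"] assms
    by (simp only: ereal_W flow_in_Dom diff_ge_0_iff_ge)
  then show ?thesis
    using flow_flow[OF u \<open>0 \<le> r\<close>, of "t - r"] assms by simp
qed

text \<open>
  Since \<open>V\<close> decreases along the flow, its value at the final time \<open>h\<close> may replace the running value
  on the right side of the evolution variational inequality.
\<close>
lemma evi_integrated:
  assumes u: "u \<in> Dom V" and v: "v \<in> Dom V" and "0 \<le> h"
  shows "(dist (S h u) v)\<^sup>2
      \<le> exp (- \<kappa> * h) * (dist u v)\<^sup>2 + 2 * (W v - W (S h u)) * ((1 - exp (- \<kappa> * h)) / \<kappa>)"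
proof -
  have "(dist (S h u) v)\<^sup>2
      \<le> exp (- \<kappa> * h) * (dist (S 0 u) v)\<^sup>2 + 2 * (W v - W (S h u)) * ((1 - exp (- \<kappa> * h)) / \<kappa>)"
  proof (rule gronwall_upper_right_deriv[where f = "\<lambda>t. (dist (S t u) v)\<^sup>2"])
    show "continuous_on {0..h} (\<lambda>t. (dist (S t u) v)\<^sup>2)"
      by (intro continuous_intros continuous_on_subset[OF continuous_on_flow[OF u]]) auto
  next
    fix r assume r: "0 \<le> r" "r < h"
    have "2 * (W v - W (S r u)) - \<kappa> * (dist (S r u) v)\<^sup>2 \<le> 2 * (W v - W (S h u)) - \<kappa> * (dist (S r u) v)\<^sup>2"
      using W_flow_antimono[OF u, of r h] r by simp
    then show "upper_right_deriv (\<lambda>t. (dist (S t u) v)\<^sup>2) r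
        \<le> ereal (2 * (W v - W (S h u)) - \<kappa> * (dist (S r u) v)\<^sup>2)"
      using evi[OF u v r(1)] by (meson ereal_less_eq(3) order_trans)
  qed (use \<kappa>_pos \<open>0 \<le> h\<close> in auto)
  then show ?thesis by (simp add: flow_0[OF u])
qed

text \<open>
  Lower semicontinuity bounds the limit from below, monotonicity along the flow from above.
\<close>
lemma W_flow_tendsto:
  assumes u: "u \<in> Dom V"
  shows "((\<lambda>h. W (S h u)) \<longlongrightarrow> W u) (at_right 0)"
proof (rule order_tendstoI)
  have pos: "\<forall>\<^sub>F h in at_right (0::real). 0 < h"
    by (simp add: eventually_at_right_less)
  {
    fix c assume "c < W u"
    then have "ereal c < ereal (W u)" by simp
    then have "ereal c < V u" by (simp only: ereal_W[OF u])
    then have "\<forall>\<^sub>F y in nhds u. ereal c < V y"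
      by (rule lower_semicontinuous_eventually_greater[OF lsc])
    then have "\<forall>\<^sub>F h in at_right 0. ereal c < V (S h u)"
      using flow_tendsto_id[OF u] by (rule eventually_compose_filterlim)
    with pos show "\<forall>\<^sub>F h in at_right 0. c < W (S h u)"
    proof eventually_elim
      case (elim h)
      then have "ereal c < ereal (W (S h u))"
        using u by (simp only: ereal_W flow_in_Dom less_imp_le)
      then show ?case by simp
    qed
  next
    fix c assume "W u < c"
    from pos show "\<forall>\<^sub>F h in at_right 0. W (S h u) < c"
    proof eventually_elim
      case (elim h)
      then show ?case using W_flow_antimono[OF u, of 0 h] \<open>W u < c\<close> by (simp add: flow_0[OF u])
    qed
  }
qed

text \<open>
  The two trajectories are advanced one after the other: with \<open>a, b\<close> at time \<open>t\<close> and \<open>a', b'\<close> at time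
  \<open>t + h\<close>, the integrated inequality is applied to \<open>a\<close> with \<open>v = b\<close> and then to \<open>b\<close> with \<open>v = a'\<close>. The
  energies of \<open>a'\<close> cancel to first order, and the remaining difference \<open>V b - V b'\<close> vanishes as \<open>h\<close>
  tends to zero.
\<close>
lemma flow_pair_deriv:
  assumes u: "u \<in> Dom V" and v: "v \<in> Dom V" and t: "0 \<le> t"
  shows "upper_right_deriv (\<lambda>t. (dist (S t u) (S t v))\<^sup>2) t
           \<le> ereal (0 - 2 * \<kappa> * (dist (S t u) (S t v))\<^sup>2)"
proof -
  define a b where "a = S t u" and "b = S t v"
  have ab: "a \<in> Dom V" "b \<in> Dom V" unfolding a_def b_def using assms by (auto intro: flow_in_Dom)
  define q e where "q h = exp (- \<kappa> * h)" and "e h = (1 - exp (- \<kappa> * h)) / \<kappa>" for h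
  define R where "R h = ((q h)\<^sup>2 - 1) / h * (dist a b)\<^sup>2
      + 2 * (e h / h) * (q h * (W b - W (S h b)) + (1 - q h) * (W (S h a) - W (S h b)))" for h
  have q: "(q \<longlongrightarrow> 1) (at_right 0)"
    unfolding q_def by (auto intro!: tendsto_eq_intros)
  have dq: "((\<lambda>h. (1 - q h) / h) \<longlongrightarrow> \<kappa>) (at_right 0)"
  proof -
    have "((\<lambda>h. 1 - q h) has_real_derivative \<kappa>) (at 0)"
      unfolding q_def by (auto intro!: derivative_eq_intros)
    then have "((\<lambda>h. (1 - q h) / h) \<longlongrightarrow> \<kappa>) (at 0)"
      unfolding DERIV_def by (simp add: q_def)
    then show ?thesis by (rule tendsto_mono[rotated]) (simp add: at_le)
  qed
  have de: "((\<lambda>h. e h / h) \<longlongrightarrow> 1) (at_right 0)"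
  proof -
    have "((\<lambda>h. (1 - q h) / h / \<kappa>) \<longlongrightarrow> \<kappa> / \<kappa>) (at_right 0)"
      using \<kappa>_pos by (intro tendsto_divide dq tendsto_const) auto
    then show ?thesis using \<kappa>_pos by (simp add: e_def q_def field_simps)
  qed
  have "((\<lambda>h. - ((1 - q h) / h) * (1 + q h) * (dist a b)\<^sup>2
      + 2 * (e h / h) * (q h * (W b - W (S h b)) + (1 - q h) * (W (S h a) - W (S h b))))
      \<longlongrightarrow> - \<kappa> * (1 + 1) * (dist a b)\<^sup>2 + 2 * 1 * (1 * (W b - W b) + (1 - 1) * (W a - W b))) (at_right 0)"
    by (intro tendsto_intros q dq de W_flow_tendsto ab)
  moreover have "R = (\<lambda>h. - ((1 - q h) / h) * (1 + q h) * (dist a b)\<^sup>2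
      + 2 * (e h / h) * (q h * (W b - W (S h b)) + (1 - q h) * (W (S h a) - W (S h b))))"
  proof -
    have "((q h)\<^sup>2 - 1) / h = - ((1 - q h) / h) * (1 + q h)" for h
      by (cases "h = 0") (auto simp: field_simps power2_eq_square)
    then show ?thesis unfolding R_def by auto
  qed
  ultimately have "(R \<longlongrightarrow> - \<kappa> * (1 + 1) * (dist a b)\<^sup>2
      + 2 * 1 * (1 * (W b - W b) + (1 - 1) * (W a - W b))) (at_right 0)"
    by (simp only:)
  then have R: "(R \<longlongrightarrow> 0 - 2 * \<kappa> * (dist a b)\<^sup>2) (at_right 0)" by (simp add: mult.commute[of \<kappa> 2])
  have "\<forall>\<^sub>F h in at_right 0. ereal (((dist (S (t + h) u) (S (t + h) v))\<^sup>2 - (dist (S t u) (S t v))\<^sup>2) / h)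
      \<le> ereal (R h)"
  proof (rule eventually_at_rightI[of 0 1])
    fix h :: real assume "h \<in> {0<..<1}"
    then have h: "h > 0" by simp
    define a' b' where "a' = S h a" and "b' = S h b"
    have ab': "a' \<in> Dom V" "b' \<in> Dom V" using ab h by (auto simp: a'_def b'_def intro: flow_in_Dom)
    have 1: "(dist a' b)\<^sup>2 \<le> q h * (dist a b)\<^sup>2 + 2 * (W b - W a') * e h"
      using evi_integrated[OF ab(1,2), of h] h by (simp add: q_def e_def a'_def)
    have 2: "(dist a' b')\<^sup>2 \<le> q h * (dist a' b)\<^sup>2 + 2 * (W a' - W b') * e h"
      using evi_integrated[OF ab(2) ab'(1), of h] h by (simp add: q_def e_def b'_def dist_commute)
    also have "\<dots> \<le> q h * (q h * (dist a b)\<^sup>2 + 2 * (W b - W a') * e h) + 2 * (W a' - W b') * e h"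
      using 1 by (intro add_right_mono mult_left_mono) (auto simp: q_def)
    finally have "(dist a' b')\<^sup>2 - (dist a b)\<^sup>2
        \<le> ((q h)\<^sup>2 - 1) * (dist a b)\<^sup>2 + 2 * e h * (q h * (W b - W b') + (1 - q h) * (W a' - W b'))"
      by (simp add: algebra_simps power2_eq_square)
    from divide_right_mono[OF this, of h] h
    have "((dist a' b')\<^sup>2 - (dist a b)\<^sup>2) / h \<le> R h"
      by (simp add: R_def a'_def b'_def add_divide_distrib)
    then show "ereal (((dist (S (t + h) u) (S (t + h) v))\<^sup>2 - (dist (S t u) (S t v))\<^sup>2) / h) \<le> ereal (R h)"
      using flow_flow[OF u t, of h] flow_flow[OF v t, of h] h by (simp add: a'_def b'_def a_def b_def)
  qed simp
  then have "upper_right_deriv (\<lambda>t. (dist (S t u) (S t v))\<^sup>2) t \<le> Limsup (at_right 0) (\<lambda>h. ereal (R h))"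
    unfolding upper_right_deriv_def by (rule Limsup_mono)
  also have "\<dots> = ereal (0 - 2 * \<kappa> * (dist a b)\<^sup>2)"
    using R by (intro lim_imp_Limsup) (auto simp: trivial_limit_at_right_real)
  finally show ?thesis by (simp add: a_def b_def)
qed

lemma flow_contraction:
  assumes u: "u \<in> Dom V" and v: "v \<in> Dom V" and t: "0 \<le> t"
  shows "dist (S t u) (S t v) \<le> exp (- \<kappa> * t) * dist u v"
proof -
  have "(dist (S t u) (S t v))\<^sup>2
      \<le> exp (- (2 * \<kappa>) * t) * (dist (S 0 u) (S 0 v))\<^sup>2 + 0 * ((1 - exp (- (2 * \<kappa>) * t)) / (2 * \<kappa>))"
  proof (rule gronwall_upper_right_deriv[where f = "\<lambda>t. (dist (S t u) (S t v))\<^sup>2"])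
    show "continuous_on {0..t} (\<lambda>t. (dist (S t u) (S t v))\<^sup>2)"
      by (intro continuous_intros continuous_on_subset[OF continuous_on_flow[OF u]]
          continuous_on_subset[OF continuous_on_flow[OF v]]) auto
  qed (use flow_pair_deriv[OF u v] \<kappa>_pos t in auto)
  also have "\<dots> = (exp (- \<kappa> * t) * dist u v)\<^sup>2"
    by (simp add: flow_0 u v power_mult_distrib flip: exp_of_nat_mult)
  finally show ?thesis by (rule power2_le_imp_le) simp
qed

end

section \<open>Slope, speed and energy dissipation\<close>

context convex_evi_flow
begin

text \<open>
  Convexity turns the local slope into a global bound: the difference quotient between \<open>z\<close> and \<open>v\<close>,
  increased by \<open>\<kappa> d / 2\<close>, is a lower bound for the limit of the quotients along a geodesic from \<open>z\<close>
  to \<open>v\<close>.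
\<close>
lemma slope_imp_global_bound:
  assumes z: "z \<in> Dom V" and v: "v \<in> Dom V" and L: "slope V z \<le> ereal L" "0 \<le> L"
  shows "W z - W v + \<kappa> / 2 * (dist z v)\<^sup>2 \<le> L * dist z v"
proof (rule ccontr)
  define d where "d = dist z v"
  assume "\<not> ?thesis"
  then have less: "L * d < W z - W v + \<kappa> / 2 * d\<^sup>2" by (simp add: d_def)
  have "d > 0"
  proof (rule ccontr)
    assume "\<not> 0 < d"
    then have "z = v" by (simp add: d_def)
    with less show False by (simp add: d_def)
  qed
  then have "L < (W z - W v + \<kappa> / 2 * d\<^sup>2) / d" using less by (simp add: field_simps)
  then obtain K where K: "L < K" "K < (W z - W v + \<kappa> / 2 * d\<^sup>2) / d" using dense by blast
  obtain c where c: "c 0 = z" "\<And>s. s \<in> {0..1} \<Longrightarrow> c s \<in> Dom V"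
      "\<And>s r. s \<in> {0..1} \<Longrightarrow> r \<in> {0..1} \<Longrightarrow> dist (c s) (c r) \<le> \<bar>s - r\<bar> * d"
      "\<And>s. s \<in> {0..1} \<Longrightarrow> V (c s) \<le> ereal (1 - s) * V z + ereal s * V v - ereal (\<kappa> / 2 * s * (1 - s) * d\<^sup>2)"
    using convex z v unfolding geodesically_convex_def d_def by metis
  have Wc: "W (c s) \<le> W z - s * (W z - W v + \<kappa> / 2 * (1 - s) * d\<^sup>2)" if "s \<in> {0..1}" for s
  proof -
    have "ereal (W (c s)) \<le> ereal (1 - s) * ereal (W z) + ereal s * ereal (W v) - ereal (\<kappa> / 2 * s * (1 - s) * d\<^sup>2)"
      using c(4)[OF that] by (simp only: ereal_W c(2)[OF that] z v)
    then show ?thesis by (simp add: algebra_simps)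
  qed
  have unit: "\<forall>\<^sub>F s in at_right (0::real). s \<in> {0<..<1}"
    by (rule eventually_at_rightI[of 0 1]) auto
  have "((\<lambda>s. (W z - W v + \<kappa> / 2 * (1 - s) * d\<^sup>2) / d) \<longlongrightarrow> (W z - W v + \<kappa> / 2 * (1 - 0) * d\<^sup>2) / d) (at_right 0)"
    using \<open>d > 0\<close> by (intro tendsto_intros) auto
  then have "\<forall>\<^sub>F s in at_right 0. K < (W z - W v + \<kappa> / 2 * (1 - s) * d\<^sup>2) / d"
    using K(2) by (intro order_tendstoD) auto
  with unit have descent: "\<forall>\<^sub>F s in at_right 0. W (c s) \<le> W z - K * (s * d) \<and> W (c s) < W z"
  proof eventually_elim
    case (elim s)
    define A where "A = W z - W v + \<kappa> / 2 * (1 - s) * d\<^sup>2"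
    have "K * d < A" using elim \<open>d > 0\<close> unfolding A_def[symmetric] by (simp add: field_simps)
    then have "s * (K * d) < s * A" using elim by simp
    moreover have "0 \<le> s * (K * d)" using elim L(2) K(1) \<open>d > 0\<close> by simp
    moreover have "W (c s) \<le> W z - s * A" using Wc[of s] elim by (simp add: A_def)
    moreover have "K * (s * d) = s * (K * d)" by simp
    ultimately show ?case by linarith
  qed
  have "(c \<longlongrightarrow> z) (at_right 0)"
    unfolding tendsto_dist_iff[of c z]
  proof (rule tendsto_sandwich[OF _ _ tendsto_const])
    show "\<forall>\<^sub>F s in at_right 0. dist (c s) z \<le> s * d"
      using unit by eventually_elim (use c(3)[of _ 0] c(1) in auto)
    show "((\<lambda>s. s * d) \<longlongrightarrow> 0) (at_right 0)" by (auto intro!: tendsto_eq_intros)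
  qed auto
  then have "filterlim c (at z) (at_right 0)"
    unfolding filterlim_at using descent by (auto elim!: eventually_mono)
  moreover have "\<forall>\<^sub>F w in at z. max 0 (V z - V w) / ereal (dist z w) < ereal K"
  proof (rule Limsup_lessD)
    have "Limsup (at z) (\<lambda>w. max 0 (V z - V w) / ereal (dist z w)) \<le> ereal L"
      using L(1) by (simp add: slope_def)
    also have "\<dots> < ereal K" using K(1) by simp
    finally show "Limsup (at z) (\<lambda>w. max 0 (V z - V w) / ereal (dist z w)) < ereal K" .
  qed
  ultimately have "\<forall>\<^sub>F s in at_right 0. max 0 (V z - V (c s)) / ereal (dist z (c s)) < ereal K"
    by (rule eventually_compose_filterlim[rotated])
  with descent unit have "\<forall>\<^sub>F s in at_right (0::real). False"
  proof eventually_elim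
    case (elim s)
    have "z \<noteq> c s" using elim by auto
    then have pos: "0 < dist z (c s)" by simp
    have "max 0 (ereal (W z) - ereal (W (c s))) / ereal (dist z (c s)) < ereal K"
      using elim z c(2)[of s] by (simp only: ereal_W greaterThanLessThan_iff atLeastAtMost_iff less_imp_le)
    moreover have "W (c s) < W z" using elim by simp
    ultimately have "W z - W (c s) < K * dist z (c s)"
      using pos by (simp add: max_def field_simps split: if_splits)
    also have "\<dots> \<le> K * (s * d)"
      using c(3)[of 0 s] c(1) elim L(2) K(1) by (intro mult_left_mono) auto
    finally show ?case using elim by simp
  qed
  then show False by (simp add: trivial_limit_at_right_real)
qed

text \<open>
  By the slope bound, the squared distance \<open>f\<close> to the starting point satisfies \<open>f' \<le> 2 L \<surd>f\<close>. It is
  compared with the strict supersolutions \<open>((L + e) (h + e))\<^sup>2\<close>.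
\<close>
lemma flow_dist_le_slope:
  assumes z: "z \<in> Dom V" and L: "slope V z \<le> ereal L" "0 \<le> L" and h: "0 \<le> h"
  shows "dist (S h z) z \<le> L * h"
proof -
  have *: "dist (S h z) z \<le> (L + e) * (h + e)" if "e > 0" for e
  proof -
    have "(dist (S h z) z)\<^sup>2 \<le> ((L + e) * (h + e))\<^sup>2"
    proof (rule comparison_upper_right_deriv[where a = 0 and b = h and f = "\<lambda>r. (dist (S r z) z)\<^sup>2"
          and g = "\<lambda>r. ((L + e) * (r + e))\<^sup>2" and g' = "\<lambda>r. 2 * (L + e) * ((L + e) * (r + e))"])
      show "continuous_on {0..h} (\<lambda>r. (dist (S r z) z)\<^sup>2)"
        by (intro continuous_intros continuous_on_subset[OF continuous_on_flow[OF z]]) auto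
    next
      fix r assume r: "0 \<le> r" "r < h" and eq: "(dist (S r z) z)\<^sup>2 = ((L + e) * (r + e))\<^sup>2"
      define d where "d = dist (S r z) z"
      have pos: "0 < (L + e) * (r + e)" using L \<open>e > 0\<close> r by simp
      then have d: "d = (L + e) * (r + e)"
        using eq by (simp add: d_def power2_eq_iff_nonneg)
      have "W z - W (S r z) + \<kappa> / 2 * d\<^sup>2 \<le> L * d"
        using slope_imp_global_bound[OF z flow_in_Dom[OF z r(1)] L] by (simp add: d_def dist_commute)
      then have *: "2 * (W z - W (S r z)) - \<kappa> * d\<^sup>2 \<le> 2 * L * d"
        using \<kappa>_pos by (smt (verit) mult_nonneg_nonneg zero_le_power2 field_sum_of_halves distrib_right)
      have "0 < d" using pos d by simp
      then have "2 * L * d < 2 * (L + e) * d"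
        using \<open>e > 0\<close> by (intro mult_strict_right_mono) auto
      with * have "2 * (W z - W (S r z)) - \<kappa> * (dist (S r z) z)\<^sup>2 < 2 * (L + e) * ((L + e) * (r + e))"
        unfolding d[symmetric] d_def[symmetric] by linarith
      then show "upper_right_deriv (\<lambda>r. (dist (S r z) z)\<^sup>2) r < ereal (2 * (L + e) * ((L + e) * (r + e)))"
        using evi[OF z z r(1)] by (meson le_less_trans less_ereal.simps(1))
    qed (use h z in \<open>auto intro!: derivative_eq_intros simp: flow_0\<close>)
    then show ?thesis by (rule power2_le_imp_le) (use L h that in auto)
  qed
  have "((\<lambda>e. (L + e) * (h + e)) \<longlongrightarrow> (L + 0) * (h + 0)) (at_right 0)"
    by (intro tendsto_intros)
  moreover have "\<forall>\<^sub>F e in at_right 0. dist (S h z) z \<le> (L + e) * (h + e)"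
    using * by (intro eventually_at_rightI[of 0 1]) auto
  ultimately show ?thesis
    by (intro tendsto_lowerbound[where F = "at_right 0"]) (auto simp: trivial_limit_at_right_real)
qed

text \<open>
  At time zero the squared distance to \<open>v\<close> cannot decrease faster than \<open>2 d(z, v)\<close> times the speed,
  while the evolution variational inequality forces it to decrease at rate at least
  \<open>2 (V z - V v)\<close>. A speed bound along some sequence of times tending to zero is enough.
\<close>
lemma slope_le_flow_speed:
  assumes z: "z \<in> Dom V" and L: "0 \<le> L"
    and speed: "\<exists>\<^sub>F h in at_right 0. dist (S h z) z \<le> L * h"
  shows "slope V z \<le> ereal L"
proof (rule slope_leI[OF z L], rule ccontr)
  fix v assume v: "v \<in> Dom V"
  define d where "d = dist z v"
  assume "\<not> W z - W v \<le> L * dist z v"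
  then have "L * d < W z - W v" by (simp add: d_def)
  moreover have "0 \<le> \<kappa> * d\<^sup>2" using \<kappa>_pos by simp
  moreover have "2 * - y - k < - 2 * x" if "x < y" "0 \<le> k" for x y k :: real
    using that by linarith
  ultimately have "2 * - (W z - W v) - \<kappa> * d\<^sup>2 < - 2 * (L * d)" by blast
  then have "2 * (W v - W z) - \<kappa> * d\<^sup>2 < - 2 * L * d" by simp
  moreover
  have "upper_right_deriv (\<lambda>r. (dist (S r z) v)\<^sup>2) 0 \<le> ereal (2 * (W v - W z) - \<kappa> * d\<^sup>2)"
    using evi[OF z v, of 0] by (simp add: flow_0[OF z] d_def)
  ultimately have "upper_right_deriv (\<lambda>r. (dist (S r z) v)\<^sup>2) 0 < ereal (- 2 * L * d)"
    by (meson le_less_trans less_ereal.simps(1))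
  from upper_right_deriv_lessD[OF this]
  have "\<forall>\<^sub>F h in at_right 0. (dist (S h z) v)\<^sup>2 - d\<^sup>2 < - 2 * L * d * h"
    by (simp add: flow_0[OF z] d_def)
  then have "\<forall>\<^sub>F h in at_right 0. \<not> dist (S h z) z \<le> L * h"
  proof eventually_elim
    case (elim h)
    define \<delta> where "\<delta> = dist (S h z) z"
    have "\<bar>d - \<delta>\<bar> \<le> \<bar>dist (S h z) v\<bar>"
      using dist_triangle[of z v "S h z"] dist_triangle[of "S h z" z v]
      by (auto simp: d_def \<delta>_def dist_commute)
    then have "(d - \<delta>)\<^sup>2 \<le> (dist (S h z) v)\<^sup>2" by (rule abs_le_square_iff[THEN iffD1])
    then have "d\<^sup>2 - 2 * d * \<delta> \<le> (dist (S h z) v)\<^sup>2"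
      unfolding power2_diff using zero_le_power2[of \<delta>] by linarith
    with elim have "d * (L * h) < d * \<delta>" by (simp add: mult_ac)
    moreover have "0 \<le> d" by (simp add: d_def)
    ultimately show ?case unfolding \<delta>_def by (meson mult_left_mono not_less)
  qed
  with speed show False by (simp add: frequently_def)
qed

text \<open>
  The initial speed is contracted by the flow, and it equals the slope.
\<close>
lemma slope_flow_le:
  assumes z: "z \<in> Dom V" and L: "slope V z \<le> ereal L" "0 \<le> L" and t: "0 \<le> t"
  shows "slope V (S t z) \<le> ereal (exp (- \<kappa> * t) * L)"
proof (rule slope_le_flow_speed)
  have "\<forall>\<^sub>F h in at_right (0::real). h \<in> {0<..<1}"
    by (rule eventually_at_rightI[of 0 1]) auto
  then have "\<forall>\<^sub>F h in at_right 0. dist (S h (S t z)) (S t z) \<le> exp (- \<kappa> * t) * L * h"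
  proof eventually_elim
    case (elim h)
    then have h: "0 \<le> h" by simp
    have "S h (S t z) = S t (S h z)"
      using flow_flow[OF z t h] flow_flow[OF z h t] by (simp add: add.commute)
    then have "dist (S h (S t z)) (S t z) \<le> exp (- \<kappa> * t) * dist (S h z) z"
      using flow_contraction[OF flow_in_Dom[OF z h] z t] by simp
    also have "\<dots> \<le> exp (- \<kappa> * t) * (L * h)"
      by (intro mult_left_mono flow_dist_le_slope z L h) simp
    finally show ?case by (simp add: mult_ac)
  qed
  then show "\<exists>\<^sub>F h in at_right 0. dist (S h (S t z)) (S t z) \<le> exp (- \<kappa> * t) * L * h"
    by (rule eventually_frequently[OF trivial_limit_at_right_real])
qed (use flow_in_Dom[OF z t] L in auto)

text \<open>
  The upper bound is the slope bound times the speed bound. For the lower bound, the time interval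
  up to \<open>s\<close> is cut at \<open>p s\<close> with \<open>p < 1\<close>. On the first part the speed bound controls the distance to \<open>z\<close>
  by \<open>\<sigma> p s\<close>; on the second part the integrated inequality controls the growth of its square by
  \<open>2 (1 - p) s\<close> times the energy loss \<open>B\<close>. As the distance at time \<open>s\<close> is close to \<open>\<sigma> s\<close>, the
  quotient \<open>B / s\<close> is asymptotically at least \<open>\<sigma>\<^sup>2 (1 + p) / 2\<close>, which exceeds any given \<open>c < \<sigma>\<^sup>2\<close> for
  suitable \<open>p\<close>.
\<close>
lemma energy_dissipation_at_0:
  assumes z: "z \<in> Dom V" and \<sigma>: "slope V z = ereal \<sigma>"
  shows "((\<lambda>h. (W z - W (S h z)) / h) \<longlongrightarrow> \<sigma>\<^sup>2) (at_right 0)"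
proof (rule order_tendstoI)
  have "0 \<le> slope V z" by (simp add: slope_def)
  then have \<sigma>0: "0 \<le> \<sigma>" using \<sigma> by simp
  have unit: "\<forall>\<^sub>F h in at_right (0::real). h \<in> {0<..<1}"
    by (rule eventually_at_rightI[of 0 1]) auto
  {
    fix c assume "\<sigma>\<^sup>2 < c"
    from unit show "\<forall>\<^sub>F h in at_right 0. (W z - W (S h z)) / h < c"
    proof eventually_elim
      case (elim h)
      have "W z - W (S h z) + \<kappa> / 2 * (dist z (S h z))\<^sup>2 \<le> \<sigma> * dist z (S h z)"
        using slope_imp_global_bound[OF z flow_in_Dom[OF z, of h], of \<sigma>] elim \<sigma> \<sigma>0 by simp
      moreover have "0 \<le> \<kappa> / 2 * (dist z (S h z))\<^sup>2" using \<kappa>_pos by simp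
      ultimately have "W z - W (S h z) \<le> \<sigma> * dist (S h z) z" by (simp add: dist_commute)
      also have "\<dots> \<le> \<sigma> * (\<sigma> * h)"
        using elim \<sigma> \<sigma>0 by (intro mult_left_mono flow_dist_le_slope[OF z]) auto
      also have "\<dots> < c * h" using elim \<open>\<sigma>\<^sup>2 < c\<close> by (simp add: power2_eq_square)
      finally show ?case using elim by (simp add: field_simps)
    qed
  next
    fix c assume c: "c < \<sigma>\<^sup>2"
    show "\<forall>\<^sub>F h in at_right 0. c < (W z - W (S h z)) / h"
    proof (cases "c < 0")
      case True
      from unit show ?thesis
      proof eventually_elim
        case (elim h)
        then have "0 \<le> (W z - W (S h z)) / h"
          using W_flow_antimono[OF z, of 0 h] by (simp add: flow_0[OF z])
        with True show ?case by linarith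
      qed
    next
      case False
      with c have s2: "0 < \<sigma>\<^sup>2" "0 \<le> c" by auto
      then have "0 < \<sigma>" using \<sigma>0 by (simp add: zero_less_power2)
      (* For this p the value \<sigma>^2 (1 + p) / 2 is (\<sigma>^2 + c) / 2, which exceeds c. The number L below is the
         speed for which the estimate yields exactly the rate c, and it is smaller than \<sigma>. *)
      define p where "p = c / \<sigma>\<^sup>2"
      have p: "0 \<le> p" "p < 1" "c = p * \<sigma>\<^sup>2" using c s2 by (auto simp: p_def)
      define L where "L = sqrt (2 * c * (1 - p) + (\<sigma> * p)\<^sup>2)"
      have "0 \<le> L" using p s2 by (simp add: L_def)
      have L2: "L\<^sup>2 = 2 * c * (1 - p) + (\<sigma> * p)\<^sup>2" using p s2 by (simp add: L_def)
      have "\<sigma>\<^sup>2 - L\<^sup>2 = \<sigma>\<^sup>2 * (1 - p)\<^sup>2"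
        unfolding L2 p(3) by (simp add: power2_eq_square algebra_simps)
      moreover have "0 < \<sigma>\<^sup>2 * (1 - p)\<^sup>2" using p s2 by simp
      ultimately have "L\<^sup>2 < \<sigma>\<^sup>2" by linarith
      then have "L < \<sigma>" using \<sigma>0 by (rule power2_less_imp_less)
      have "\<not> (\<exists>\<^sub>F h in at_right 0. dist (S h z) z \<le> L * h)"
        using slope_le_flow_speed[OF z \<open>0 \<le> L\<close>] \<open>L < \<sigma>\<close> \<sigma> by auto
      then have "\<forall>\<^sub>F h in at_right 0. L * h < dist (S h z) z"
        by (simp add: frequently_def not_le)
      with unit show ?thesis
      proof eventually_elim
        case (elim s)
        then have s: "0 < s" by simp
        define B where "B = W z - W (S s z)"
        define h where "h = (1 - p) * s"
        have ps: "0 \<le> p * s" "0 \<le> h" "p * s + h = s" using p s by (auto simp: h_def algebra_simps)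
        have "0 \<le> B" using W_flow_antimono[OF z, of 0 s] s by (simp add: B_def flow_0[OF z])
        have "L\<^sup>2 * s\<^sup>2 < (dist (S s z) z)\<^sup>2"
          unfolding power_mult_distrib[symmetric] using elim s \<open>0 \<le> L\<close> by (intro power_strict_mono) auto
        also have "\<dots> \<le> exp (- \<kappa> * h) * (dist (S (p * s) z) z)\<^sup>2 + 2 * B * ((1 - exp (- \<kappa> * h)) / \<kappa>)"
          using evi_integrated[OF flow_in_Dom[OF z ps(1)] z ps(2)] flow_flow[OF z ps(1,2)] ps(3)
          by (simp add: B_def)
        also have "\<dots> \<le> 1 * (\<sigma> * (p * s))\<^sup>2 + 2 * B * h"
        proof (intro add_mono mult_mono power_mono flow_dist_le_slope z ps)
          show "exp (- \<kappa> * h) \<le> 1" using \<kappa>_pos ps by simp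
          have "1 - exp (- \<kappa> * h) \<le> \<kappa> * h" using exp_ge_add_one_self[of "- \<kappa> * h"] by simp
          then show "(1 - exp (- \<kappa> * h)) / \<kappa> \<le> h" using \<kappa>_pos by (simp add: field_simps)
          show "0 \<le> (1 - exp (- \<kappa> * h)) / \<kappa>" using \<kappa>_pos ps by simp
        qed (use \<sigma> \<sigma>0 \<open>0 \<le> B\<close> in auto)
        finally have "2 * c * (1 - p) * s\<^sup>2 < 2 * B * ((1 - p) * s)"
          unfolding L2 h_def by (simp add: algebra_simps power_mult_distrib)
        then have "(2 * (1 - p) * s) * (c * s) < (2 * (1 - p) * s) * B"
          by (simp add: power2_eq_square mult_ac)
        then have "c * s < B" using p s by (simp add: mult_less_cancel_left_pos)
        then show ?case using s by (simp add: B_def field_simps)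
      qed
    qed
  }
qed

text \<open>
  The global slope bound \<open>\<sigma> d - \<kappa> d\<^sup>2 / 2\<close> is at most its maximum over \<open>d\<close>, which is \<open>\<sigma>\<^sup>2 / (2\<kappa>)\<close>.
\<close>
lemma slope_power2_ge:
  assumes z: "z \<in> Dom V" and v: "v \<in> Dom V" and \<sigma>: "slope V z \<le> ereal \<sigma>" "0 \<le> \<sigma>"
  shows "2 * \<kappa> * (W z - W v) \<le> \<sigma>\<^sup>2"
proof -
  define d where "d = dist z v"
  have "W z - W v \<le> \<sigma> * d - \<kappa> / 2 * d\<^sup>2"
    using slope_imp_global_bound[OF z v \<sigma>] by (simp add: d_def)
  from mult_left_mono[OF this, of "2 * \<kappa>"] \<kappa>_pos
  have "2 * \<kappa> * (W z - W v) \<le> 2 * \<kappa> * (\<sigma> * d - \<kappa> / 2 * d\<^sup>2)" by simp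
  also have "\<dots> = \<sigma>\<^sup>2 - (\<sigma> - \<kappa> * d)\<^sup>2" by (simp add: power2_eq_square algebra_simps)
  also have "\<dots> \<le> \<sigma>\<^sup>2" by simp
  finally show ?thesis .
qed

end

section \<open>The Fisher-type energy along the flow\<close>

text \<open>
  The model case of \<open>(slope V)\<^sup>2\<close> is the Fisher information, the squared slope of the entropy in
  Wasserstein space, whence the name.
\<close>
locale fisher_flow = convex_evi_flow +
  fixes U :: "'a \<Rightarrow> ereal" and \<theta> :: real
  assumes U_neq_MInf: "U w \<noteq> -\<infinity>"
    and Dom_subset: "Dom U \<subseteq> Dom V"
    and flow_in_Dom_U: "w \<in> Dom U \<Longrightarrow> 0 \<le> t \<Longrightarrow> S t w \<in> Dom U"
    and \<theta>_pos: "0 < \<theta>"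
    and U_eq: "w \<in> Dom U \<Longrightarrow> U w = (slope V w)\<^sup>2 + ereal (2 * (\<theta> - \<kappa>)) * V w"
begin

lemma Dom_U_imp_Dom_V: "w \<in> Dom U \<Longrightarrow> w \<in> Dom V"
  using Dom_subset by blast

lemma Dom_U_slopeE:
  assumes w: "w \<in> Dom U"
  obtains \<sigma> where "0 \<le> \<sigma>" "slope V w = ereal \<sigma>" "U w = ereal (\<sigma>\<^sup>2 + 2 * (\<theta> - \<kappa>) * W w)"
proof -
  obtain a where a: "V w = ereal a" using V_realE Dom_U_imp_Dom_V[OF w] by blast
  have nonneg: "0 \<le> slope V w" by (simp add: slope_def)
  show ?thesis
  proof (cases "slope V w")
    case (real \<sigma>)
    then show ?thesis using that[of \<sigma>] nonneg U_eq[OF w] a by (simp add: power2_eq_square)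
  next
    case PInf
    then have "U w = \<infinity>" using U_eq[OF w] a by (simp add: power2_eq_square)
    with w show ?thesis by (simp add: Dom_def)
  qed (use nonneg in auto)
qed

text \<open>
  The squared slope decreases at rate at least \<open>2\<kappa>\<sigma>\<^sup>2\<close> and \<open>V\<close> at rate exactly \<open>\<sigma>\<^sup>2\<close>; exactness is what
  makes the argument independent of the sign of \<open>\<theta> - \<kappa>\<close>.
\<close>
lemma dissipation_ge:
  assumes z: "z \<in> Dom U" and \<sigma>: "slope V z = ereal \<sigma>"
  shows "ereal (2 * \<theta> * \<sigma>\<^sup>2) \<le> dissipation S U z"
proof -
  have zV: "z \<in> Dom V" by (rule Dom_U_imp_Dom_V[OF z])
  have \<sigma>0: "0 \<le> \<sigma>" and Uz: "U z = ereal (\<sigma>\<^sup>2 + 2 * (\<theta> - \<kappa>) * W z)"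
    using Dom_U_slopeE[OF z] \<sigma> by auto
  define g where "g h = (1 - exp (- 2 * \<kappa> * h)) / h * \<sigma>\<^sup>2 + 2 * (\<theta> - \<kappa>) * ((W z - W (S h z)) / h)" for h
  have "((\<lambda>h. (1 - exp (- 2 * \<kappa> * h)) / h) \<longlongrightarrow> 2 * \<kappa>) (at_right 0)"
  proof -
    have "((\<lambda>h. 1 - exp (- 2 * \<kappa> * h)) has_real_derivative 2 * \<kappa>) (at 0)"
      by (auto intro!: derivative_eq_intros)
    then have "((\<lambda>h. (1 - exp (- 2 * \<kappa> * h)) / h) \<longlongrightarrow> 2 * \<kappa>) (at 0)"
      unfolding DERIV_def by simp
    then show ?thesis by (rule tendsto_mono[rotated]) (simp add: at_le)
  qed
  then have "(g \<longlongrightarrow> 2 * \<kappa> * \<sigma>\<^sup>2 + 2 * (\<theta> - \<kappa>) * \<sigma>\<^sup>2) (at_right 0)"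
    unfolding g_def by (intro tendsto_intros energy_dissipation_at_0[OF zV \<sigma>])
  moreover have "2 * \<kappa> * \<sigma>\<^sup>2 + 2 * (\<theta> - \<kappa>) * \<sigma>\<^sup>2 = 2 * \<theta> * \<sigma>\<^sup>2" by (simp add: algebra_simps)
  ultimately have "Limsup (at_right 0) (\<lambda>h. ereal (g h)) = ereal (2 * \<theta> * \<sigma>\<^sup>2)"
    by (intro lim_imp_Limsup) (auto simp: trivial_limit_at_right_real)
  moreover have "\<forall>\<^sub>F h in at_right 0. ereal (g h) \<le> (U z - U (S h z)) / ereal h"
  proof (rule eventually_at_rightI[of 0 1])
    fix h :: real assume "h \<in> {0<..<1}"
    then have h: "h > 0" by simp
    obtain r where r: "0 \<le> r" "slope V (S h z) = ereal r" "U (S h z) = ereal (r\<^sup>2 + 2 * (\<theta> - \<kappa>) * W (S h z))"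
      using Dom_U_slopeE[OF flow_in_Dom_U[OF z, of h]] h by auto
    have "r \<le> exp (- \<kappa> * h) * \<sigma>"
      using slope_flow_le[OF zV, of \<sigma> h] \<sigma> \<sigma>0 h r by simp
    then have "r\<^sup>2 \<le> (exp (- \<kappa> * h) * \<sigma>)\<^sup>2" using r by (intro power_mono)
    also have "\<dots> = exp (- 2 * \<kappa> * h) * \<sigma>\<^sup>2"
      by (simp add: power_mult_distrib flip: exp_of_nat_mult)
    finally have "(1 - exp (- 2 * \<kappa> * h)) * \<sigma>\<^sup>2 + 2 * (\<theta> - \<kappa>) * (W z - W (S h z))
        \<le> (\<sigma>\<^sup>2 + 2 * (\<theta> - \<kappa>) * W z) - (r\<^sup>2 + 2 * (\<theta> - \<kappa>) * W (S h z))"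
      by (simp add: algebra_simps)
    from divide_right_mono[OF this, of h] h
    show "ereal (g h) \<le> (U z - U (S h z)) / ereal h"
      unfolding Uz r(3) g_def by (simp add: add_divide_distrib)
  qed simp
  then have "Limsup (at_right 0) (\<lambda>h. ereal (g h)) \<le> dissipation S U z"
    unfolding dissipation_def by (rule Limsup_mono)
  ultimately show ?thesis by simp
qed

text \<open>
  The dissipation of \<open>U\<close> at \<open>m\<close> is at least \<open>2\<theta>\<sigma>\<^sup>2\<close>, and at most \<open>\<sigma> d / r\<close>, because the flow moves at
  speed at most \<open>\<sigma>\<close> and so changes the penalization \<open>d\<^sup>2 / (2r)\<close> at rate at most \<open>\<sigma> d / r\<close>.
\<close>
lemma minimizing_step_slope_le:
  assumes m: "m \<in> Dom U" and r: "0 < r" and \<sigma>: "slope V m = ereal \<sigma>"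
    and min: "\<And>w. w \<in> Dom U \<Longrightarrow> ereal (1 / (2 * r) * (dist m y)\<^sup>2) + U m
                   \<le> ereal (1 / (2 * r) * (dist w y)\<^sup>2) + U w"
  shows "2 * \<theta> * \<sigma> * r \<le> dist m y"
proof -
  have mV: "m \<in> Dom V" by (rule Dom_U_imp_Dom_V[OF m])
  have \<sigma>0: "0 \<le> \<sigma>" using Dom_U_slopeE[OF m] \<sigma> by auto
  define d where "d = dist m y"
  have "\<forall>\<^sub>F h in at_right 0. ereal (((dist (S (0 + h) m) y)\<^sup>2 - (dist (S 0 m) y)\<^sup>2) / h)
          \<le> ereal (\<sigma> * (2 * d + \<sigma> * h))"
  proof (rule eventually_at_rightI[of 0 1])
    fix h :: real assume "h \<in> {0<..<1}"
    then have h: "h > 0" by simp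
    have "dist (S h m) y \<le> d + \<sigma> * h"
      using dist_triangle[of "S h m" y m] flow_dist_le_slope[OF mV, of \<sigma> h] \<sigma> \<sigma>0 h by (simp add: d_def)
    then have "(dist (S h m) y)\<^sup>2 \<le> (d + \<sigma> * h)\<^sup>2" by (intro power_mono) auto
    then have "(dist (S h m) y)\<^sup>2 - d\<^sup>2 \<le> \<sigma> * (2 * d + \<sigma> * h) * h"
      by (simp add: power2_eq_square algebra_simps)
    then show "ereal (((dist (S (0 + h) m) y)\<^sup>2 - (dist (S 0 m) y)\<^sup>2) / h) \<le> ereal (\<sigma> * (2 * d + \<sigma> * h))"
      using h by (simp add: flow_0[OF mV] d_def pos_divide_le_eq)
  qed simp
  then have "upper_right_deriv (\<lambda>r. (dist (S r m) y)\<^sup>2) 0 \<le> Limsup (at_right 0) (\<lambda>h. ereal (\<sigma> * (2 * d + \<sigma> * h)))"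
    unfolding upper_right_deriv_def by (rule Limsup_mono)
  also have "\<dots> = ereal (\<sigma> * (2 * d + \<sigma> * 0))"
    by (intro lim_imp_Limsup tendsto_intros) (simp add: trivial_limit_at_right_real)
  finally have "ereal (1 / (2 * r)) * upper_right_deriv (\<lambda>r. (dist (S r m) y)\<^sup>2) 0
      \<le> ereal (1 / (2 * r)) * ereal (\<sigma> * (2 * d + \<sigma> * 0))"
    using r by (intro ereal_mult_left_mono) auto
  then have "ereal (2 * \<theta> * \<sigma>\<^sup>2) \<le> ereal (1 / (2 * r)) * ereal (\<sigma> * (2 * d + \<sigma> * 0))"
    using dissipation_le_distance_deriv[OF m mV U_neq_MInf r min] dissipation_ge[OF m \<sigma>]
    by (meson order_trans)
  then have "2 * \<theta> * \<sigma>\<^sup>2 * r \<le> \<sigma> * d" using r by (simp add: field_simps)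
  then have "\<sigma> * (2 * \<theta> * \<sigma> * r) \<le> \<sigma> * d" by (simp add: power2_eq_square mult_ac)
  then show ?thesis
    using \<sigma>0 by (cases "\<sigma> = 0") (auto simp: d_def mult_le_cancel_left)
qed

end

section \<open>Variational interpolation\<close>

text \<open>
  Here \<open>D r\<close> and \<open>E r\<close> are the squared distance and the energy of a minimizing step of size \<open>r\<close>, and
  \<open>E0\<close> is the energy of the starting point. Using the minimizer for size \<open>r\<close> as a competitor for size
  \<open>s > r\<close> bounds the drop of the minimal value \<open>\<phi>\<close> from \<open>r\<close> to \<open>s\<close> below by \<open>D r (1 / (2r) - 1 / (2s))\<close>.
  Summed along a geometric sequence of sizes with ratio \<open>q\<close> close to \<open>1\<close>, this replaces the
  integration of \<open>\<phi>' = -D r / (2r\<^sup>2)\<close> and gives \<open>\<phi> \<tau> + k\<tau>/2 \<le> E0\<close>; the second half of \<open>k\<tau>\<close> is the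
  penalization contained in \<open>\<phi> \<tau>\<close>.
\<close>
lemma variational_interpolation_decay:
  fixes D E :: "real \<Rightarrow> real"
  assumes "0 < \<tau>"
    and min: "\<And>r s. 0 < r \<Longrightarrow> r \<le> \<tau> \<Longrightarrow> 0 < s \<Longrightarrow> s \<le> \<tau> \<Longrightarrow> D r / (2 * r) + E r \<le> D s / (2 * r) + E s"
    and init: "\<And>r. 0 < r \<Longrightarrow> r \<le> \<tau> \<Longrightarrow> D r / (2 * r) + E r \<le> E0"
    and growth: "\<And>r. 0 < r \<Longrightarrow> r \<le> \<tau> \<Longrightarrow> k * r\<^sup>2 \<le> D r"
  shows "E \<tau> + k * \<tau> \<le> E0"
proof -
  define \<phi> where "\<phi> r = D r / (2 * r) + E r" for r
  have step: "\<phi> s + k / 2 * (q * (1 - q) * s) \<le> \<phi> (q * s)" if "0 < q" "q < 1" "0 < s" "s \<le> \<tau>" for q s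
  proof -
    have qs: "0 < q * s" "q * s \<le> \<tau>"
      using that mult_right_mono[of q 1 s] by (auto intro: order_trans[of _ s])
    have "k * (q * s)\<^sup>2 * ((1 - q) / (2 * (q * s))) \<le> D (q * s) * ((1 - q) / (2 * (q * s)))"
      using growth[OF qs] that by (intro mult_right_mono) auto
    moreover have "k * (q * s)\<^sup>2 * ((1 - q) / (2 * (q * s))) = k / 2 * (q * (1 - q) * s)"
      using that by (simp add: power2_eq_square field_simps)
    moreover have "D (q * s) * ((1 - q) / (2 * (q * s))) = D (q * s) / (2 * (q * s)) - D (q * s) / (2 * s)"
      using that by (simp add: field_simps)
    ultimately show ?thesis using min[OF that(3,4) qs] unfolding \<phi>_def by linarith
  qed
  have sum: "\<phi> \<tau> + k / 2 * (q * (1 - q ^ n) * \<tau>) \<le> \<phi> (q ^ n * \<tau>)" if q: "0 < q" "q < 1" for q n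
  proof (induction n)
    case (Suc n)
    have "q ^ n * \<tau> \<le> \<tau>" using q \<open>0 < \<tau>\<close> mult_right_mono[of "q ^ n" 1 \<tau>] by (simp add: power_le_one)
    then have "\<phi> (q ^ n * \<tau>) + k / 2 * (q * (1 - q) * (q ^ n * \<tau>)) \<le> \<phi> (q * (q ^ n * \<tau>))"
      using q \<open>0 < \<tau>\<close> by (intro step) auto
    then show ?case using Suc by (simp add: algebra_simps)
  qed simp
  have "\<phi> \<tau> + k / 2 * (q * (1 - 0) * \<tau>) \<le> E0" if q: "0 < q" "q < 1" for q
  proof (rule tendsto_upperbound)
    show "(\<lambda>n. \<phi> \<tau> + k / 2 * (q * (1 - q ^ n) * \<tau>)) \<longlonglongrightarrow> \<phi> \<tau> + k / 2 * (q * (1 - 0) * \<tau>)"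
      using q by (intro tendsto_intros LIMSEQ_power_zero) auto
    have "\<phi> \<tau> + k / 2 * (q * (1 - q ^ n) * \<tau>) \<le> E0" for n
    proof -
      have "q ^ n * \<tau> \<le> \<tau>" using q \<open>0 < \<tau>\<close> mult_right_mono[of "q ^ n" 1 \<tau>] by (simp add: power_le_one)
      then have "\<phi> (q ^ n * \<tau>) \<le> E0" unfolding \<phi>_def using q \<open>0 < \<tau>\<close> by (intro init) auto
      with sum[OF q] show ?thesis by (rule order_trans)
    qed
    then show "\<forall>\<^sub>F n in sequentially. \<phi> \<tau> + k / 2 * (q * (1 - q ^ n) * \<tau>) \<le> E0" by simp
  qed simp
  then have ev: "\<forall>\<^sub>F q in at_left 1. \<phi> \<tau> + k / 2 * (q * (1 - 0) * \<tau>) \<le> E0"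
    by (intro eventually_at_leftI[of 0]) auto
  have "((\<lambda>q. \<phi> \<tau> + k / 2 * (q * (1 - 0) * \<tau>)) \<longlongrightarrow> \<phi> \<tau> + k / 2 * (1 * (1 - 0) * \<tau>)) (at_left 1)"
    by (intro tendsto_intros)
  from tendsto_upperbound[OF this ev]
  have "\<phi> \<tau> + k / 2 * \<tau> \<le> E0" by (simp add: trivial_limit_at_left_real)
  moreover have "k / 2 * \<tau> + E \<tau> \<le> \<phi> \<tau>"
    using divide_right_mono[OF growth[of \<tau>], of "2 * \<tau>"] \<open>0 < \<tau>\<close>
    by (simp add: \<phi>_def power2_eq_square)
  ultimately show ?thesis by simp
qed

section \<open>Decay rates along minimizing steps\<close>

context fisher_flow
begin

lemma V_gap_le_dissipation:
  assumes z: "z \<in> Dom U" and v: "v \<in> Dom V"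
  shows "ereal (4 * \<kappa> * \<theta> * (W z - W v)) \<le> dissipation S U z"
proof -
  obtain \<sigma> where \<sigma>: "0 \<le> \<sigma>" "slope V z = ereal \<sigma>" using Dom_U_slopeE[OF z] by blast
  have "2 * \<theta> * (2 * \<kappa> * (W z - W v)) \<le> 2 * \<theta> * \<sigma>\<^sup>2"
    using slope_power2_ge[OF Dom_U_imp_Dom_V[OF z] v] \<sigma> \<theta>_pos by (intro mult_left_mono) auto
  then have "ereal (4 * \<kappa> * \<theta> * (W z - W v)) \<le> ereal (2 * \<theta> * \<sigma>\<^sup>2)" by (simp add: mult_ac)
  also note dissipation_ge[OF z \<sigma>(2)]
  finally show ?thesis .
qed

lemma V_decay:
  assumes m: "m \<in> Dom U" and \<tau>: "0 < \<tau>" and v: "v \<in> Dom V"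
    and min: "\<And>w. w \<in> Dom U \<Longrightarrow> ereal (1 / (2 * \<tau>) * (dist m y)\<^sup>2) + U m
                   \<le> ereal (1 / (2 * \<tau>) * (dist w y)\<^sup>2) + U w"
  shows "ereal (1 + 4 * \<kappa> * \<theta> * \<tau>) * (V m - V v) \<le> V y - V v"
proof (cases "y \<in> Dom V")
  case False
  then show ?thesis using v by (auto simp: Dom_def)
next
  case True
  have mV: "m \<in> Dom V" by (rule Dom_U_imp_Dom_V[OF m])
  have "V m + ereal \<tau> * ereal (4 * \<kappa> * \<theta> * (W m - W v)) + 0
      \<le> V m + ereal \<tau> * dissipation S U m + ereal (\<kappa> / 2 * (dist m y)\<^sup>2)"
    using V_gap_le_dissipation[OF m v] \<tau> \<kappa>_pos by (intro add_mono ereal_mult_left_mono) auto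
  also have "\<dots> \<le> V y"
    by (rule minimizing_step_decreases[OF m Dom_subset U_neq_MInf \<tau> min])
  finally have *: "V m + ereal \<tau> * ereal (4 * \<kappa> * \<theta> * (W m - W v)) + 0 \<le> V y" .
  obtain a b c where "V m = ereal a" "V y = ereal b" "V v = ereal c"
    using V_realE[OF mV] V_realE[OF True] V_realE[OF v] by metis
  with * show ?thesis by (simp add: algebra_simps)
qed

text \<open>
  The decay estimate for \<open>V\<close>, started at the minimum point, leaves no room for any positive gap.
\<close>
lemma minimizing_step_from_minimizer:
  assumes x: "x \<in> Dom V" and xmin: "\<And>w. V w \<le> V x \<Longrightarrow> w = x"
    and m: "m \<in> Dom U" and \<tau>: "0 < \<tau>"
    and min: "\<And>w. w \<in> Dom U \<Longrightarrow> ereal (1 / (2 * \<tau>) * (dist m x)\<^sup>2) + U m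
                   \<le> ereal (1 / (2 * \<tau>) * (dist w x)\<^sup>2) + U w"
  shows "m = x"
proof (rule xmin)
  obtain a b where ab: "V m = ereal a" "V x = ereal b"
    using V_realE[OF x] V_realE[OF Dom_U_imp_Dom_V[OF m]] by metis
  have "(1 + 4 * \<kappa> * \<theta> * \<tau>) * (a - b) \<le> 0"
    using V_decay[OF m \<tau> x min] ab by simp
  moreover have "0 < 1 + 4 * \<kappa> * \<theta> * \<tau>" using \<kappa>_pos \<theta>_pos \<tau> by (simp add: add_pos_pos)
  ultimately show "V m \<le> V x" using ab by (simp add: mult_le_0_iff)
qed

lemma U_at_minimizer:
  assumes x: "x \<in> Dom U" and xmin: "\<And>w. V x \<le> V w"
  shows "U x = ereal (2 * (\<theta> - \<kappa>) * W x)"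
proof -
  have xV: "x \<in> Dom V" by (rule Dom_U_imp_Dom_V[OF x])
  have "slope V x \<le> ereal 0"
  proof (rule slope_leI[OF xV])
    fix v assume v: "v \<in> Dom V"
    have "ereal (W x) \<le> ereal (W v)" using xmin[of v] by (simp only: ereal_W xV v)
    then show "W x - W v \<le> 0 * dist x v" by simp
  qed simp
  moreover obtain \<sigma> where "0 \<le> \<sigma>" "slope V x = ereal \<sigma>" "U x = ereal (\<sigma>\<^sup>2 + 2 * (\<theta> - \<kappa>) * W x)"
    using Dom_U_slopeE[OF x] by blast
  ultimately show ?thesis by simp
qed

text \<open>
  The gap of \<open>U\<close> is \<open>\<sigma>\<^sup>2 + 2(\<theta> - \<kappa>)a\<close> with \<open>0 \<le> 2\<kappa>a \<le> \<sigma>\<^sup>2\<close>: it is at most \<open>\<sigma>\<^sup>2\<close> for \<open>\<theta> \<le> \<kappa>\<close> and at most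
  \<open>\<theta>\<sigma>\<^sup>2 / \<kappa>\<close> otherwise.
\<close>
lemma U_gap:
  assumes z: "z \<in> Dom U" and x: "x \<in> Dom U" and xmin: "\<And>w. V x \<le> V w"
    and \<sigma>: "slope V z = ereal \<sigma>"
  obtains g where "U z - U x = ereal g" "2 * \<theta> * (W z - W x) \<le> g" "min \<kappa> \<theta> * g \<le> \<theta> * \<sigma>\<^sup>2"
proof -
  have xV: "x \<in> Dom V" and zV: "z \<in> Dom V" using Dom_U_imp_Dom_V x z by auto
  have \<sigma>0: "0 \<le> \<sigma>" and Uz: "U z = ereal (\<sigma>\<^sup>2 + 2 * (\<theta> - \<kappa>) * W z)"
    using Dom_U_slopeE[OF z] \<sigma> by auto
  define a where "a = W z - W x"
  have "ereal (W x) \<le> ereal (W z)" using xmin[of z] by (simp only: ereal_W xV zV)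
  then have a0: "0 \<le> a" by (simp add: a_def)
  have a2: "2 * \<kappa> * a \<le> \<sigma>\<^sup>2"
    using slope_power2_ge[OF zV xV _ \<sigma>0] \<sigma> by (simp add: a_def)
  show ?thesis
  proof (rule that[of "\<sigma>\<^sup>2 + 2 * (\<theta> - \<kappa>) * a"])
    show "U z - U x = ereal (\<sigma>\<^sup>2 + 2 * (\<theta> - \<kappa>) * a)"
      unfolding Uz U_at_minimizer[OF x xmin] by (simp add: a_def algebra_simps)
    show "2 * \<theta> * (W z - W x) \<le> \<sigma>\<^sup>2 + 2 * (\<theta> - \<kappa>) * a"
      using a2 by (simp add: a_def algebra_simps)
    show "min \<kappa> \<theta> * (\<sigma>\<^sup>2 + 2 * (\<theta> - \<kappa>) * a) \<le> \<theta> * \<sigma>\<^sup>2"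
    proof (cases "\<theta> \<le> \<kappa>")
      case True
      then have "2 * (\<theta> - \<kappa>) * a \<le> 0" by - (rule mult_nonpos_nonneg, use a0 True in auto)
      then have "\<theta> * (\<sigma>\<^sup>2 + 2 * (\<theta> - \<kappa>) * a) \<le> \<theta> * \<sigma>\<^sup>2"
        using \<theta>_pos by (intro mult_left_mono) auto
      with True show ?thesis by (simp add: min_def)
    next
      case False
      then have "(\<theta> - \<kappa>) * (2 * \<kappa> * a) \<le> (\<theta> - \<kappa>) * \<sigma>\<^sup>2"
        using a2 by (intro mult_left_mono) auto
      then have "\<kappa> * (\<sigma>\<^sup>2 + 2 * (\<theta> - \<kappa>) * a) \<le> \<theta> * \<sigma>\<^sup>2" by (simp add: algebra_simps)
      with False show ?thesis by (simp add: min_def)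
    qed
  qed
qed

lemma is_min_point_U_iff:
  assumes x: "x \<in> Dom U" and xmin: "\<And>w. V x \<le> V w" and uniq: "\<And>w. V w \<le> V x \<Longrightarrow> w = x"
  shows "is_min_point U w \<longleftrightarrow> w = x"
proof -
  obtain b where b: "U x = ereal b" using U_at_minimizer[OF x xmin] by blast
  have less: "U x < U w" if "w \<noteq> x" for w
  proof (cases "w \<in> Dom U")
    case True
    have wV: "w \<in> Dom V" and xV: "x \<in> Dom V" using Dom_U_imp_Dom_V True x by auto
    have "ereal (W x) < ereal (W w)"
      using uniq[of w] that by (simp only: ereal_W wV xV) (metis not_le)
    then have "0 < 2 * \<theta> * (W w - W x)" using \<theta>_pos by simp
    moreover obtain \<sigma> where "slope V w = ereal \<sigma>" using Dom_U_slopeE[OF True] by blast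
    then obtain g where "U w - U x = ereal g" "2 * \<theta> * (W w - W x) \<le> g"
      using U_gap[OF True x xmin] by blast
    ultimately show ?thesis using b by (cases "U w") auto
  next
    case False
    then show ?thesis using b by (simp add: Dom_def)
  qed
  then show ?thesis
    unfolding is_arg_min_def by (metis less_asym less_irrefl)
qed

text \<open>
  With \<open>G = U m - U x\<close>, every minimizing step of size \<open>r \<le> \<tau>\<close> out of \<open>y\<close> has squared length at least
  \<open>4\<theta> (min \<kappa> \<theta>) G r\<^sup>2\<close>, since the energy of its end point is at least that of \<open>m\<close>; variational
  interpolation concludes.
\<close>
lemma U_decay:
  assumes x: "x \<in> Dom U" and xmin: "\<And>w. V x \<le> V w"
    and \<tau>: "0 < \<tau>" and m: "m \<in> Dom U"
    and min: "\<And>w. w \<in> Dom U \<Longrightarrow> ereal (1 / (2 * \<tau>) * (dist m y)\<^sup>2) + U m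
                   \<le> ereal (1 / (2 * \<tau>) * (dist w y)\<^sup>2) + U w"
    and ex: "\<And>r. 0 < r \<Longrightarrow> r < \<tau> \<Longrightarrow> \<exists>p\<in>Dom U. \<forall>w\<in>Dom U. ereal (1 / (2 * r) * (dist p y)\<^sup>2) + U p
                   \<le> ereal (1 / (2 * r) * (dist w y)\<^sup>2) + U w"
  shows "ereal (1 + 4 * \<theta> * min \<kappa> \<theta> * \<tau>) * (U m - U x) \<le> U y - U x"
proof (cases "y \<in> Dom U")
  case False
  then show ?thesis using U_at_minimizer[OF x xmin] by (simp add: Dom_def)
next
  case True
  have ereal_U: "ereal (real_of_ereal (U w)) = U w" if "w \<in> Dom U" for w
    using that U_neq_MInf[of w] by (cases "U w") (auto simp: Dom_def)
  define F where "F w = real_of_ereal (U w)" for w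
  have "\<exists>p\<in>Dom U. (r = \<tau> \<longrightarrow> p = m) \<and> (\<forall>w\<in>Dom U. ereal (1 / (2 * r) * (dist p y)\<^sup>2) + U p
      \<le> ereal (1 / (2 * r) * (dist w y)\<^sup>2) + U w)" if "r \<in> {0<..\<tau>}" for r
    using that ex[of r] m min by (cases "r = \<tau>") auto
  then obtain p where p: "\<And>r. r \<in> {0<..\<tau>} \<Longrightarrow> p r \<in> Dom U" "p \<tau> = m"
      "\<And>r w. r \<in> {0<..\<tau>} \<Longrightarrow> w \<in> Dom U \<Longrightarrow> ereal (1 / (2 * r) * (dist (p r) y)\<^sup>2) + U (p r)
          \<le> ereal (1 / (2 * r) * (dist w y)\<^sup>2) + U w"
    using \<tau> by (metis greaterThanAtMost_iff order_refl)
  define D E where "D r = (dist (p r) y)\<^sup>2" and "E r = F (p r)" for r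
  have minF: "D r / (2 * r) + E r \<le> (dist w y)\<^sup>2 / (2 * r) + F w" if "r \<in> {0<..\<tau>}" "w \<in> Dom U" for r w
  proof -
    have "ereal (1 / (2 * r) * (dist (p r) y)\<^sup>2) + ereal (F (p r)) \<le> ereal (1 / (2 * r) * (dist w y)\<^sup>2) + ereal (F w)"
      using p(3)[OF that] unfolding F_def by (simp only: ereal_U that p(1))
    then show ?thesis by (simp add: D_def E_def)
  qed
  define k where "k = 4 * \<theta> * min \<kappa> \<theta> * (F m - F x)"
  have "E \<tau> + k * \<tau> \<le> F y"
  proof (rule variational_interpolation_decay[where D = D])
    show "D r / (2 * r) + E r \<le> D s / (2 * r) + E s" if "0 < r" "r \<le> \<tau>" "0 < s" "s \<le> \<tau>" for r s
      using minF[of r "p s"] p(1)[of s] that by (simp add: D_def E_def)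
    show "D r / (2 * r) + E r \<le> F y" if "0 < r" "r \<le> \<tau>" for r
      using minF[of r y] True that by simp
    show "k * r\<^sup>2 \<le> D r" if r: "0 < r" "r \<le> \<tau>" for r
    proof -
      have pr: "p r \<in> Dom U" using p(1) r by simp
      (* Smaller steps move less and leave more energy: add the two minimality inequalities. *)
      have "F m \<le> F (p r)"
      proof (cases "r = \<tau>")
        case False
        then have "r < \<tau>" using r by simp
        have "D r / (2 * r) + E r \<le> D \<tau> / (2 * r) + E \<tau>"
          using minF[of r m] m r p(2) by (simp add: D_def E_def)
        moreover have *: "D \<tau> / (2 * \<tau>) + E \<tau> \<le> D r / (2 * \<tau>) + E r"
          using minF[of \<tau> "p r"] pr \<tau> by (simp add: D_def E_def)
        moreover have "(D \<tau> - D r) * (1 / (2 * r) - 1 / (2 * \<tau>))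
            = D \<tau> / (2 * r) - D r / (2 * r) - D \<tau> / (2 * \<tau>) + D r / (2 * \<tau>)"
          by (simp add: algebra_simps diff_divide_distrib)
        ultimately have "0 \<le> (D \<tau> - D r) * (1 / (2 * r) - 1 / (2 * \<tau>))" by linarith
        moreover have "0 < 1 / (2 * r) - 1 / (2 * \<tau>)"
          using \<open>r < \<tau>\<close> r by (simp add: field_simps)
        ultimately have "D r \<le> D \<tau>" by (simp add: zero_le_mult_iff)
        then have "D r / (2 * \<tau>) \<le> D \<tau> / (2 * \<tau>)" using \<tau> by (intro divide_right_mono) auto
        with * have "E \<tau> \<le> E r" by linarith
        then show ?thesis by (simp add: E_def p(2))
      qed (simp add: p(2))
      obtain \<sigma> where \<sigma>: "0 \<le> \<sigma>" "slope V (p r) = ereal \<sigma>" using Dom_U_slopeE[OF pr] by blast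
      obtain g where g: "U (p r) - U x = ereal g" "min \<kappa> \<theta> * g \<le> \<theta> * \<sigma>\<^sup>2"
        using U_gap[OF pr x xmin \<sigma>(2)] by blast
      have "ereal (F (p r)) - ereal (F x) = ereal g"
        using g(1) unfolding F_def by (simp only: ereal_U pr x)
      then have "g = F (p r) - F x" by simp
      with \<open>F m \<le> F (p r)\<close> have "min \<kappa> \<theta> * (F m - F x) \<le> min \<kappa> \<theta> * g"
        using \<kappa>_pos \<theta>_pos by (intro mult_left_mono) auto
      with g(2) have "min \<kappa> \<theta> * (F m - F x) \<le> \<theta> * \<sigma>\<^sup>2" by linarith
      from mult_left_mono[OF this, of "4 * \<theta> * r\<^sup>2"]
      have "k * r\<^sup>2 \<le> (2 * \<theta> * \<sigma> * r)\<^sup>2"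
        using \<theta>_pos by (simp add: k_def power_mult_distrib power2_eq_square mult_ac)
      also have "\<dots> \<le> (dist (p r) y)\<^sup>2"
        using minimizing_step_slope_le[OF pr r(1) \<sigma>(2)] p(3)[of r] r \<sigma>(1) \<theta>_pos
        by (intro power_mono) auto
      finally show ?thesis by (simp add: D_def)
    qed
  qed (use \<tau> in auto)
  then have "ereal (1 + 4 * \<theta> * min \<kappa> \<theta> * \<tau>) * (ereal (F m) - ereal (F x)) \<le> ereal (F y) - ereal (F x)"
    by (simp add: E_def p(2) k_def algebra_simps)
  then show ?thesis unfolding F_def by (simp only: ereal_U m x True)
qed

end

theorem theorem3p2:
  fixes V U :: "'a::complete_space \<Rightarrow> ereal"
    and S :: "real \<Rightarrow> 'a \<Rightarrow> 'a"
    and \<kappa> \<tau>o :: real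
    and \<tau> :: "nat \<Rightarrow> real"
    and u :: "nat \<Rightarrow> 'a"
  assumes "\<And>w. V w \<noteq> -\<infinity>"
    and "Dom V \<noteq> {}"
    and "lower_semicontinuous V"
    and "geodesically_convex \<kappa> V"
    and "is_flow \<kappa> V S"
    and "\<And>w. U w \<noteq> -\<infinity>"
    and "lower_semicontinuous U"
    and "Dom U \<subseteq> Dom V"
    and "\<tau>o > 0"
    and "\<And>\<sigma> y. 0 < \<sigma> \<Longrightarrow> \<sigma> \<le> \<tau>o \<Longrightarrow>
           \<exists>m\<in>Dom U. is_min_point (\<lambda>w. ereal (1 / (2 * \<sigma>) * (dist w y)\<^sup>2) + U w) m"
    and "\<And>n. n \<ge> 1 \<Longrightarrow> 0 < \<tau> n \<and> \<tau> n \<le> \<tau>o"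
    and "filterlim (\<lambda>N. \<Sum>n=1..N. \<tau> n) at_top sequentially"
    and "\<And>n w. n \<ge> 1 \<Longrightarrow> w \<in> Dom U \<Longrightarrow>
           ereal (1 / (2 * \<tau> n) * (dist (u n) (u (n - 1)))\<^sup>2) + U (u n)
             \<le> ereal (1 / (2 * \<tau> n) * (dist w (u (n - 1)))\<^sup>2) + U w"
  shows
    "(\<forall>n\<ge>1. V (u n) + ereal (\<tau> n) * dissipation S U (u n)
               + ereal (\<kappa> / 2 * (dist (u n) (u (n - 1)))\<^sup>2) \<le> V (u (n - 1))) \<and>
     (\<forall>\<theta>. \<kappa> > 0 \<and> \<theta> > 0 \<and>
          (\<forall>w\<in>Dom U. U w = (slope V w)\<^sup>2 + ereal (2 * (\<theta> - \<kappa>)) * V w) \<and>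
          (\<forall>w\<in>Dom U. \<forall>t\<ge>0. S t w \<in> Dom U)
        \<longrightarrow> (\<exists>umin.
              (\<forall>w. is_min_point V w \<longleftrightarrow> w = umin) \<and>
              (\<forall>w. is_min_point U w \<longleftrightarrow> w = umin) \<and>
              (\<forall>n\<ge>1. ereal (1 + 4 * \<kappa> * \<theta> * \<tau> n) * (V (u n) - V umin)
                        \<le> V (u (n - 1)) - V umin) \<and>
              (\<forall>n\<ge>1. ereal (1 + 4 * \<theta> * min \<kappa> \<theta> * \<tau> n) * (U (u n) - U umin)
                        \<le> U (u (n - 1)) - U umin)))"
proof (intro conjI allI impI)
  interpret evi_flow V S \<kappa>
    using assms(1,3,5) by unfold_locales
  note step_min = assms(13)
  have ex: "\<exists>m\<in>Dom U. \<forall>w\<in>Dom U. ereal (1 / (2 * r) * (dist m y)\<^sup>2) + U m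
      \<le> ereal (1 / (2 * r) * (dist w y)\<^sup>2) + U w" if "0 < r" "r \<le> \<tau>o" for r y
    using assms(10)[OF that, of y] unfolding is_arg_min_def by (meson not_le)
  have uDom: "u n \<in> Dom U" if "1 \<le> n" for n
  proof -
    obtain w where w: "w \<in> Dom U" using ex[of \<tau>o] \<open>0 < \<tau>o\<close> by blast
    have "ereal (1 / (2 * \<tau> n) * (dist w (u (n - 1)))\<^sup>2) + U w < \<infinity>"
      using w by (simp add: Dom_def)
    with step_min[OF that w] show ?thesis
      by (cases "U (u n)") (auto simp: Dom_def)
  qed
  {
    fix n :: nat assume n: "1 \<le> n"
    show "V (u n) + ereal (\<tau> n) * dissipation S U (u n)
               + ereal (\<kappa> / 2 * (dist (u n) (u (n - 1)))\<^sup>2) \<le> V (u (n - 1))"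
      using assms(11)[OF n] by (intro minimizing_step_decreases uDom n assms(6,8) step_min) auto
  }
  fix \<theta> :: real
  assume hyp: "\<kappa> > 0 \<and> \<theta> > 0 \<and>
      (\<forall>w\<in>Dom U. U w = (slope V w)\<^sup>2 + ereal (2 * (\<theta> - \<kappa>)) * V w) \<and>
      (\<forall>w\<in>Dom U. \<forall>t\<ge>0. S t w \<in> Dom U)"
  interpret fisher_flow V S \<kappa> U \<theta>
    using assms(4,6,8) hyp by unfold_locales auto
  obtain x where x: "x \<in> Dom V" "\<And>w. V x \<le> V w" "\<And>w. V w \<le> V x \<Longrightarrow> w = x"
    using convex_ex1_minimizer[OF assms(4) \<kappa>_pos assms(3) assms(1,2)] by blast
  (* A minimizing step started at the minimum point of V ends in Dom U without moving. *)
  have xU: "x \<in> Dom U"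
  proof -
    obtain m where m: "m \<in> Dom U" "\<And>w. w \<in> Dom U \<Longrightarrow> ereal (1 / (2 * \<tau>o) * (dist m x)\<^sup>2) + U m
        \<le> ereal (1 / (2 * \<tau>o) * (dist w x)\<^sup>2) + U w"
      using ex[of \<tau>o x] \<open>0 < \<tau>o\<close> by blast
    then have "m = x"
      using x(1,3) \<open>0 < \<tau>o\<close> by (intro minimizing_step_from_minimizer[of x m \<tau>o]) auto
    with m show ?thesis by simp
  qed
  show "\<exists>umin.
        (\<forall>w. is_min_point V w \<longleftrightarrow> w = umin) \<and>
        (\<forall>w. is_min_point U w \<longleftrightarrow> w = umin) \<and>
        (\<forall>n\<ge>1. ereal (1 + 4 * \<kappa> * \<theta> * \<tau> n) * (V (u n) - V umin)
                  \<le> V (u (n - 1)) - V umin) \<and>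
        (\<forall>n\<ge>1. ereal (1 + 4 * \<theta> * min \<kappa> \<theta> * \<tau> n) * (U (u n) - U umin)
                  \<le> U (u (n - 1)) - U umin)"
  proof (intro exI[of _ x] conjI allI impI)
    show "is_min_point V w \<longleftrightarrow> w = x" for w
      unfolding is_arg_min_def using x(2,3) by (metis not_le)
    show "is_min_point U w \<longleftrightarrow> w = x" for w
      by (rule is_min_point_U_iff[OF xU x(2,3)])
    fix n :: nat assume n: "1 \<le> n"
    have \<tau>n: "0 < \<tau> n" "\<tau> n \<le> \<tau>o" using assms(11)[OF n] by auto
    show "ereal (1 + 4 * \<kappa> * \<theta> * \<tau> n) * (V (u n) - V x) \<le> V (u (n - 1)) - V x"
      by (rule V_decay[OF uDom[OF n] \<tau>n(1) x(1) step_min[OF n]])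
    show "ereal (1 + 4 * \<theta> * min \<kappa> \<theta> * \<tau> n) * (U (u n) - U x) \<le> U (u (n - 1)) - U x"
      by (rule U_decay[OF xU x(2) \<tau>n(1) uDom[OF n] step_min[OF n] ex]) (use \<tau>n in auto)
  qed
qed

end
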